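(* Let $n\ge1$ and let $(Q,\sigma)$ be the equioriented symmetric quiver of type $A_{2n}$: vertices $1,\dots,2n$, arrows $a_i:i\to i+1$ ($1\le i\le 2n-1$), $\sigma(i)=2n+1-i$, $\sigma(a_i)=a_{2n-i}$. Let $\alpha$ be a symmetric dimension vector, written $(\alpha_1,\dots,\alpha_n)$ with $\alpha_i=\alpha_{2n+1-i}$, and for $V\in SpRep(Q,\alpha)$ write $V(a_i)$ for the linear maps of the corresponding symplectic representation (so $V(a_n):V_n\to V_n^*$ is symmetric and $V(a_{2n-i})=-V(a_i)^t$). Then $SpSI(Q,\alpha)$ is generated by the following semi-invariants: (i) $\det(V(a_i)\cdots V(a_j))$ for $1\le j\le i\le n-1$ such that $\alpha_j=\alpha_{i+1}<\min\{\alpha_{j+1},\dots,\alpha_i\}$ (the condition on the minimum being vacuous when $i=j$); (ii) $\det(V(a_{2n-i})\cdots V(a_i))$ (a map $V_i\to V_{2n+1-i}\cong V_i^*$) for $1\le i\le n$ such that $\alpha_i<\min\{\alpha_{i+1},\dots,\alpha_n\}$ (vacuous when $i=n$).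
   Context: $\mathbb{K}$ is algebraically closed of characteristic 0. For a symmetric quiver $(Q,\sigma)$ (involution $\sigma$ of vertices and arrows reversing arrows, with $\sigma(a)=a$ whenever $\sigma(ta)=ha$) and symmetric dimension vector $\alpha$, here $Q_0^+=\{1,\dots,n\}$, $Q_1^+=\{a_1,\dots,a_{n-1}\}$, $Q_1^\sigma=\{a_n\}$, and $SpRep(Q,\alpha)=\bigoplus_{i=1}^{n-1}\mathrm{Hom}(\mathbb{K}^{\alpha_i},\mathbb{K}^{\alpha_{i+1}})\oplus S_2(\mathbb{K}^{\alpha_n})^*$ with the action of $SSp(Q,\alpha)=\prod_{i=1}^n SL(\alpha_i)$ by $g\cdot V=(g_{ha}V(a)g_{ta}^{-1})$, $g_{\sigma(x)}:=(g_x^{-1})^t$; $SpSI(Q,\alpha)=\mathbb{K}[SpRep(Q,\alpha)]^{SSp(Q,\alpha)}$. *)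

theory Defs
  imports "Jordan_Normal_Form.Determinant" "HOL-Computational_Algebra.Polynomial"
begin

text \<open>Symplectic representations of the equioriented symmetric quiver of type A_2n.
  A point V :: nat => 'k mat stores V(a_i) for 1 <= i <= n-1 (an alpha(i+1) x alpha(i) matrix)
  and V(a_n) (a symmetric alpha(n) x alpha(n) matrix, i.e. an element of S_2(K^alpha_n)^* ).
  The dimension vector is given by its first half alpha(1),...,alpha(n).\<close>

definition alg_closed_field :: "'k::field itself \<Rightarrow> bool" where
  "alg_closed_field _ \<longleftrightarrow> (\<forall>p :: 'k poly. degree p \<ge> 1 \<longrightarrow> (\<exists>x. poly p x = 0))"

definition SpRep :: "nat \<Rightarrow> (nat \<Rightarrow> nat) \<Rightarrow> (nat \<Rightarrow> 'k::field mat) set" where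
  "SpRep n \<alpha> = {V. (\<forall>i. 1 \<le> i \<and> i < n \<longrightarrow> V i \<in> carrier_mat (\<alpha> (i+1)) (\<alpha> i))
                   \<and> V n \<in> carrier_mat (\<alpha> n) (\<alpha> n) \<and> transpose_mat (V n) = V n}"

definition SSp :: "nat \<Rightarrow> (nat \<Rightarrow> nat) \<Rightarrow> ((nat \<Rightarrow> 'k::field mat) \<times> (nat \<Rightarrow> 'k mat)) set" where
  "SSp n \<alpha> = {(g, h). \<forall>i. 1 \<le> i \<and> i \<le> n \<longrightarrow>
      g i \<in> carrier_mat (\<alpha> i) (\<alpha> i) \<and> h i \<in> carrier_mat (\<alpha> i) (\<alpha> i) \<and>
      g i * h i = 1\<^sub>m (\<alpha> i) \<and> h i * g i = 1\<^sub>m (\<alpha> i) \<and> det (g i) = 1}"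

text \<open>Action g.V = (g_{ha} V(a) g_{ta}^{-1}) with g_{sigma(x)} = (g_x^{-1})^t; here h = g^{-1}.\<close>
definition act :: "nat \<Rightarrow> (nat \<Rightarrow> 'k::field mat) \<Rightarrow> (nat \<Rightarrow> 'k mat) \<Rightarrow> (nat \<Rightarrow> 'k mat) \<Rightarrow> (nat \<Rightarrow> 'k mat)" where
  "act n g h V = (\<lambda>i. if 1 \<le> i \<and> i < n then g (i+1) * V i * h i
                      else if i = n then transpose_mat (h n) * V n * h n
                      else V i)"

inductive_set poly_fun :: "nat \<Rightarrow> (nat \<Rightarrow> nat) \<Rightarrow> ((nat \<Rightarrow> 'k::field mat) \<Rightarrow> 'k) set"
  for n :: nat and \<alpha> :: "nat \<Rightarrow> nat" where
  pf_const: "(\<lambda>V. c) \<in> poly_fun n \<alpha>"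
| pf_coord: "1 \<le> i \<Longrightarrow> i < n \<Longrightarrow> r < \<alpha> (i+1) \<Longrightarrow> s < \<alpha> i \<Longrightarrow> (\<lambda>V. V i $$ (r, s)) \<in> poly_fun n \<alpha>"
| pf_coord_n: "r < \<alpha> n \<Longrightarrow> s < \<alpha> n \<Longrightarrow> (\<lambda>V. V n $$ (r, s)) \<in> poly_fun n \<alpha>"
| pf_add: "f \<in> poly_fun n \<alpha> \<Longrightarrow> f' \<in> poly_fun n \<alpha> \<Longrightarrow> (\<lambda>V. f V + f' V) \<in> poly_fun n \<alpha>"
| pf_mult: "f \<in> poly_fun n \<alpha> \<Longrightarrow> f' \<in> poly_fun n \<alpha> \<Longrightarrow> (\<lambda>V. f V * f' V) \<in> poly_fun n \<alpha>"

text \<open>Semi-invariants for SSp(Q,alpha): functions that agree on SpRep with a polynomial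
  function and are invariant on SpRep (functions are only meaningful on SpRep).\<close>
definition SpSI :: "nat \<Rightarrow> (nat \<Rightarrow> nat) \<Rightarrow> ((nat \<Rightarrow> 'k::field mat) \<Rightarrow> 'k) set" where
  "SpSI n \<alpha> = {f. (\<exists>q \<in> poly_fun n \<alpha>. \<forall>V \<in> SpRep n \<alpha>. f V = q V) \<and> (\<forall>V \<in> SpRep n \<alpha>. \<forall>(g, h) \<in> SSp n \<alpha>. f (act n g h V) = f V)}"

inductive_set gen_alg :: "('x \<Rightarrow> 'k::field) set \<Rightarrow> ('x \<Rightarrow> 'k) set" for G where
  ga_const: "(\<lambda>x. c) \<in> gen_alg G"
| ga_gen: "f \<in> G \<Longrightarrow> f \<in> gen_alg G"
| ga_add: "f \<in> gen_alg G \<Longrightarrow> f' \<in> gen_alg G \<Longrightarrow> (\<lambda>x. f x + f' x) \<in> gen_alg G"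
| ga_mult: "f \<in> gen_alg G \<Longrightarrow> f' \<in> gen_alg G \<Longrightarrow> (\<lambda>x. f x * f' x) \<in> gen_alg G"

definition full_map :: "nat \<Rightarrow> (nat \<Rightarrow> 'k::field mat) \<Rightarrow> nat \<Rightarrow> 'k mat" where
  "full_map n V k = (if k \<le> n then V k else - transpose_mat (V (2*n - k)))"

fun chain :: "(nat \<Rightarrow> 'k::field mat) \<Rightarrow> nat \<Rightarrow> nat \<Rightarrow> 'k mat" where
  "chain F j 0 = F j"
| "chain F j (Suc m) = F (j + Suc m) * chain F j m"

definition gens_i :: "nat \<Rightarrow> (nat \<Rightarrow> nat) \<Rightarrow> ((nat \<Rightarrow> 'k::field mat) \<Rightarrow> 'k) set" where
  "gens_i n \<alpha> = {(\<lambda>V. det (chain V j (i - j))) | i j.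
      1 \<le> j \<and> j \<le> i \<and> i \<le> n - 1 \<and> \<alpha> j = \<alpha> (i+1) \<and> (\<forall>k. j < k \<and> k \<le> i \<longrightarrow> \<alpha> j < \<alpha> k)}"

definition gens_ii :: "nat \<Rightarrow> (nat \<Rightarrow> nat) \<Rightarrow> ((nat \<Rightarrow> 'k::field mat) \<Rightarrow> 'k) set" where
  "gens_ii n \<alpha> = {(\<lambda>V. det (chain (full_map n V) i (2*n - 2*i))) | i.
      1 \<le> i \<and> i \<le> n \<and> (\<forall>k. i < k \<and> k \<le> n \<longrightarrow> \<alpha> i < \<alpha> k)}"

end

theory Submission
  imports Defs
begin

text \<open>
  Consider the slice of representations all of whose matrices are (rectangular) diagonal. A semi-invariant
  restricts to a polynomial in the diagonal entries which is invariant under the diagonal torus of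
  \<open>\<Prod>SL(\<alpha> i)\<close>, hence to a linear combination of torus-invariant monomials. Such a monomial is, up to a
  sign, a product of restricted generators: its topmost nonzero row is supported on an interval of arrows that
  is bounded by vertices of minimal dimension, or that reaches the symmetric form, and invariance makes the
  exponents decrease with the row, so the generator of that interval divides the monomial.

  It remains to see that a semi-invariant which vanishes on the slice is zero. Gaussian elimination by
  unitriangular matrices moves a representation with nonzero pivots into the slice, one pivot at a time, from
  arrow \<open>1\<close> to arrow \<open>n\<close>; nonzero pivots can be assumed since polynomials on lines have finitely many zeros.
\<close>

subsection \<open>The generators are semi-invariants\<close>

text \<open>All operations used in the elimination are unitriangular, so they lie in the special
  linear groups, but for the same reason the pivots are not normalised: they stay as coordinates of
  the slice, and the diagonal torus rescales them. This is why torus weights decide which functions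
  survive on the slice.

  The difficulty of the elimination is that clearing one pivot can make a later diagonal entry zero,
  so nonvanishing of the pivots is not preserved along the way. The argument therefore does not
  normalise a single generic representation. Vanishing of a semi-invariant is transported backwards
  through nested sets of partially diagonal representations, with a fresh perturbation before each
  pivot.

  The form is special in two ways. The same group element acts on both of its sides, so row and
  column operations cannot be chosen independently, and its torus weights are doubled. The first is
  resolved by symmetry of the form; the second accounts for the squares in the restricted
  determinants of the second family.\<close>

definition tgt_dim :: "nat \<Rightarrow> (nat \<Rightarrow> nat) \<Rightarrow> nat \<Rightarrow> nat" where
  "tgt_dim n \<alpha> i = (if i = n then \<alpha> n else \<alpha> (i + 1))"

text \<open>The number of diagonal entries of arrow \<open>i\<close>. The form maps the space at
  vertex \<open>n\<close> to its dual, so \<open>\<alpha> (n + 1)\<close> does not enter.\<close>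

definition min_dim :: "nat \<Rightarrow> (nat \<Rightarrow> nat) \<Rightarrow> nat \<Rightarrow> nat" where
  "min_dim n \<alpha> i = min (tgt_dim n \<alpha> i) (\<alpha> i)"

lemma SpRep_carrier:
  "V \<in> SpRep n \<alpha> \<Longrightarrow> 1 \<le> i \<Longrightarrow> i \<le> n \<Longrightarrow> V i \<in> carrier_mat (tgt_dim n \<alpha> i) (\<alpha> i)"
  by (auto simp: SpRep_def tgt_dim_def)

lemma SpRep_iff:
  assumes "n \<ge> 1"
  shows "V \<in> SpRep n \<alpha> \<longleftrightarrow>
    (\<forall>i. 1 \<le> i \<and> i \<le> n \<longrightarrow> V i \<in> carrier_mat (tgt_dim n \<alpha> i) (\<alpha> i)) \<and> transpose_mat (V n) = V n"
  using assms by (auto simp: SpRep_def tgt_dim_def le_less)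

lemma SpRep_sym:
  assumes "V \<in> SpRep n \<alpha>" "r < \<alpha> n" "s < \<alpha> n"
  shows "V n $$ (r, s) = V n $$ (s, r)"
proof -
  have "V n \<in> carrier_mat (\<alpha> n) (\<alpha> n)" "transpose_mat (V n) = V n" using assms by (auto simp: SpRep_def)
  then show ?thesis using assms by (metis carrier_matD index_transpose_mat(1))
qed

lemma poly_fun_coord:
  assumes "1 \<le> i" "i \<le> n" "r < tgt_dim n \<alpha> i" "s < \<alpha> i"
  shows "(\<lambda>V. V i $$ (r, s)) \<in> poly_fun n \<alpha>"
  using assms by (cases "i = n") (auto simp: tgt_dim_def intro: poly_fun.intros)

text \<open>Through \<open>tgt_dim\<close> the arrows and the form share one coordinate case, so
  later inductions treat them together.\<close>

lemma poly_fun_induct' [consumes 2, case_names const coord add mult]: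
  assumes "q \<in> poly_fun n \<alpha>" "n \<ge> 1"
    and "\<And>c. P (\<lambda>V. c)"
    and "\<And>i r s. 1 \<le> i \<Longrightarrow> i \<le> n \<Longrightarrow> r < tgt_dim n \<alpha> i \<Longrightarrow> s < \<alpha> i \<Longrightarrow> P (\<lambda>V. V i $$ (r, s))"
    and "\<And>f g. P f \<Longrightarrow> P g \<Longrightarrow> P (\<lambda>V. f V + g V)"
    and "\<And>f g. P f \<Longrightarrow> P g \<Longrightarrow> P (\<lambda>V. f V * g V)"
  shows "P q"
  using assms(1)
proof induction
  case (pf_coord i r s)
  then show ?case using assms(4)[of i r s] by (simp add: tgt_dim_def)
next
  case (pf_coord_n r s)
  then show ?case using assms(2) assms(4)[of n r s] by (simp add: tgt_dim_def)
qed (use assms in auto)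

section \<open>Polynomial functions and matrices on the representation space\<close>

definition poly_on_rep :: "nat \<Rightarrow> (nat \<Rightarrow> nat) \<Rightarrow> ((nat \<Rightarrow> 'k::field mat) \<Rightarrow> 'k) \<Rightarrow> bool" where
  "poly_on_rep n \<alpha> f \<longleftrightarrow> (\<exists>q \<in> poly_fun n \<alpha>. \<forall>V \<in> SpRep n \<alpha>. f V = q V)"

lemma poly_on_rep_const: "poly_on_rep n \<alpha> (\<lambda>V. c)"
  unfolding poly_on_rep_def by (rule bexI[OF _ pf_const]) auto

lemma poly_on_rep_add:
  assumes "poly_on_rep n \<alpha> f" "poly_on_rep n \<alpha> g"
  shows "poly_on_rep n \<alpha> (\<lambda>V. f V + g V)"
proof -
  obtain p q where "p \<in> poly_fun n \<alpha>" "q \<in> poly_fun n \<alpha>"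
    "\<forall>V \<in> SpRep n \<alpha>. f V = p V" "\<forall>V \<in> SpRep n \<alpha>. g V = q V"
    using assms unfolding poly_on_rep_def by blast
  then show ?thesis unfolding poly_on_rep_def by (intro bexI[OF _ pf_add[of p _ _ q]]) auto
qed

lemma poly_on_rep_mult:
  assumes "poly_on_rep n \<alpha> f" "poly_on_rep n \<alpha> g"
  shows "poly_on_rep n \<alpha> (\<lambda>V. f V * g V)"
proof -
  obtain p q where "p \<in> poly_fun n \<alpha>" "q \<in> poly_fun n \<alpha>"
    "\<forall>V \<in> SpRep n \<alpha>. f V = p V" "\<forall>V \<in> SpRep n \<alpha>. g V = q V"
    using assms unfolding poly_on_rep_def by blast
  then show ?thesis unfolding poly_on_rep_def by (intro bexI[OF _ pf_mult[of p _ _ q]]) auto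
qed

lemma poly_on_rep_sum:
  "(\<And>x. x \<in> A \<Longrightarrow> poly_on_rep n \<alpha> (f x)) \<Longrightarrow> poly_on_rep n \<alpha> (\<lambda>V. \<Sum>x\<in>A. f x V)"
  by (induction A rule: infinite_finite_induct) (auto intro: poly_on_rep_const poly_on_rep_add)

lemma poly_on_rep_prod:
  "(\<And>x. x \<in> A \<Longrightarrow> poly_on_rep n \<alpha> (f x)) \<Longrightarrow> poly_on_rep n \<alpha> (\<lambda>V. \<Prod>x\<in>A. f x V)"
  by (induction A rule: infinite_finite_induct) (auto intro: poly_on_rep_const poly_on_rep_mult)

lemma poly_on_rep_cong:
  "poly_on_rep n \<alpha> f \<Longrightarrow> (\<And>V. V \<in> SpRep n \<alpha> \<Longrightarrow> f V = g V) \<Longrightarrow> poly_on_rep n \<alpha> g"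
  unfolding poly_on_rep_def by simp

definition poly_mat :: "nat \<Rightarrow> (nat \<Rightarrow> nat) \<Rightarrow> nat \<Rightarrow> nat \<Rightarrow> ((nat \<Rightarrow> 'k::field mat) \<Rightarrow> 'k mat) \<Rightarrow> bool" where
  "poly_mat n \<alpha> a b M \<longleftrightarrow> (\<forall>V \<in> SpRep n \<alpha>. M V \<in> carrier_mat a b) \<and>
     (\<forall>r<a. \<forall>s<b. poly_on_rep n \<alpha> (\<lambda>V. M V $$ (r, s)))"

lemma poly_mat_arrow:
  assumes "1 \<le> i" "i \<le> n"
  shows "poly_mat n \<alpha> (tgt_dim n \<alpha> i) (\<alpha> i) (\<lambda>V. V i)"
  unfolding poly_mat_def poly_on_rep_def
  using SpRep_carrier[OF _ assms] by (auto intro!: bexI[OF _ poly_fun_coord[OF assms]])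

lemma poly_mat_mult:
  fixes M :: "(nat \<Rightarrow> 'k::field mat) \<Rightarrow> 'k mat"
  assumes M: "poly_mat n \<alpha> a b M" and N: "poly_mat n \<alpha> b c N"
  shows "poly_mat n \<alpha> a c (\<lambda>V. M V * N V)"
  unfolding poly_mat_def
proof (intro conjI ballI allI impI)
  fix V :: "nat \<Rightarrow> 'k mat" assume "V \<in> SpRep n \<alpha>"
  then show "M V * N V \<in> carrier_mat a c" using assms unfolding poly_mat_def by auto
next
  fix r s assume rs: "r < a" "s < c"
  have "poly_on_rep n \<alpha> (\<lambda>V. \<Sum>x\<in>{0..<b}. M V $$ (r, x) * N V $$ (x, s))"
    using M N rs unfolding poly_mat_def by (intro poly_on_rep_sum poly_on_rep_mult) auto
  then show "poly_on_rep n \<alpha> (\<lambda>V. (M V * N V) $$ (r, s))"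
  proof (rule poly_on_rep_cong)
    fix V :: "nat \<Rightarrow> 'k mat" assume "V \<in> SpRep n \<alpha>"
    then have "M V \<in> carrier_mat a b" "N V \<in> carrier_mat b c"
      using M N unfolding poly_mat_def by auto
    then show "(\<Sum>x\<in>{0..<b}. M V $$ (r, x) * N V $$ (x, s)) = (M V * N V) $$ (r, s)"
      using rs by (auto simp: scalar_prod_def intro!: sum.cong)
  qed
qed

lemma poly_mat_uminus_transpose:
  fixes M :: "(nat \<Rightarrow> 'k::field mat) \<Rightarrow> 'k mat"
  assumes M: "poly_mat n \<alpha> a b M"
  shows "poly_mat n \<alpha> b a (\<lambda>V. - transpose_mat (M V))"
  unfolding poly_mat_def
proof (intro conjI ballI allI impI)
  fix V :: "nat \<Rightarrow> 'k mat" assume "V \<in> SpRep n \<alpha>"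
  then show "- transpose_mat (M V) \<in> carrier_mat b a" using M unfolding poly_mat_def by auto
next
  fix r s assume rs: "r < b" "s < a"
  have "poly_on_rep n \<alpha> (\<lambda>V. - 1 * M V $$ (s, r))"
    using M rs unfolding poly_mat_def by (intro poly_on_rep_const poly_on_rep_mult) auto
  then show "poly_on_rep n \<alpha> (\<lambda>V. (- transpose_mat (M V)) $$ (r, s))"
  proof (rule poly_on_rep_cong)
    fix V :: "nat \<Rightarrow> 'k mat" assume "V \<in> SpRep n \<alpha>"
    then have "M V \<in> carrier_mat a b" using M unfolding poly_mat_def by auto
    then show "- 1 * M V $$ (s, r) = (- transpose_mat (M V)) $$ (r, s)" using rs by auto
  qed
qed

text \<open>The Leibniz expansion has a fixed index range only on \<open>SpRep n \<alpha>\<close>,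
  where the size of \<open>M V\<close> is known; polynomiality is accordingly tested there.\<close>

lemma poly_on_rep_det:
  fixes M :: "(nat \<Rightarrow> 'k::field mat) \<Rightarrow> 'k mat"
  assumes M: "poly_mat n \<alpha> a a M"
  shows "poly_on_rep n \<alpha> (\<lambda>V. det (M V))"
proof -
  have "poly_on_rep n \<alpha> (\<lambda>V. \<Sum>p\<in>{p. p permutes {0..<a}}. signof p * (\<Prod>i\<in>{0..<a}. M V $$ (i, p i)))"
  proof (intro poly_on_rep_sum poly_on_rep_mult poly_on_rep_const poly_on_rep_prod)
    fix p i assume "p \<in> {p. p permutes {0..<a}}" "i \<in> {0..<a}"
    then have "i < a" "p i < a" by (auto simp: permutes_def dest: permutes_in_image)
    then show "poly_on_rep n \<alpha> (\<lambda>V. M V $$ (i, p i))" using M unfolding poly_mat_def by auto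
  qed
  then show ?thesis
  proof (rule poly_on_rep_cong)
    fix V :: "nat \<Rightarrow> 'k mat" assume "V \<in> SpRep n \<alpha>"
    then have "M V \<in> carrier_mat a a" using M unfolding poly_mat_def by auto
    then show "(\<Sum>p\<in>{p. p permutes {0..<a}}. signof p * (\<Prod>i\<in>{0..<a}. M V $$ (i, p i))) = det (M V)"
      by (simp add: det_def)
  qed
qed

lemma poly_mat_chain:
  assumes "\<And>k. j \<le> k \<Longrightarrow> k \<le> j + m \<Longrightarrow> poly_mat n \<alpha> (d (k + 1)) (d k) (\<lambda>V. F V k)"
  shows "poly_mat n \<alpha> (d (j + m + 1)) (d j) (\<lambda>V. chain (F V) j m)"
  using assms
proof (induction m)
  case 0
  then show ?case by simp
next
  case (Suc m)
  have "poly_mat n \<alpha> (d (j + m + 1)) (d j) (\<lambda>V. chain (F V) j m)"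
    using Suc.prems by (intro Suc.IH) auto
  moreover have "poly_mat n \<alpha> (d (j + Suc m + 1)) (d (j + m + 1)) (\<lambda>V. F V (j + Suc m))"
    using Suc.prems[of "j + Suc m"] by simp
  ultimately show ?case using poly_mat_mult by simp
qed

section \<open>Path products under change of basis\<close>

lemma conj_mult_mat:
  fixes F :: "'a::semiring_1 mat"
  assumes "F \<in> carrier_mat a b" "C \<in> carrier_mat b c" "A \<in> carrier_mat a a"
    "H \<in> carrier_mat b b" "G \<in> carrier_mat b b" "K \<in> carrier_mat c c" "H * G = 1\<^sub>m b"
  shows "(A * F * H) * (G * C * K) = A * (F * C) * K"
proof -
  have "(A * F * H) * (G * C * K) = A * F * (H * (G * C * K))"
    by (rule assoc_mult_mat[of _ a b _ b _ c]) (use assms in auto)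
  also have "H * (G * C * K) = (H * G) * (C * K)"
    using assms(2,4-6) by (simp add: assoc_mult_mat[of _ b b _ c _ c] assoc_mult_mat[of _ b b _ b _ c])
  also have "\<dots> = C * K"
    unfolding assms(7) by (rule left_mult_one_mat') (use assms in auto)
  also have "A * F * (C * K) = A * F * C * K"
    by (rule assoc_mult_mat[of _ a b _ c _ c, symmetric]) (use assms in auto)
  also have "A * F * C = A * (F * C)"
    by (rule assoc_mult_mat[of _ a a _ b _ c]) (use assms in auto)
  finally show ?thesis .
qed

text \<open>At every interior vertex the factors \<open>H k\<close> and \<open>G k\<close> of
  consecutive arrows cancel, so only the two end vertices act. With determinant 1 at both ends, the
  determinant of a square path product is invariant.\<close>

lemma chain_conj:
  assumes "\<And>k. j \<le> k \<Longrightarrow> k \<le> j + m \<Longrightarrow> F k \<in> carrier_mat (d (k + 1)) (d k)"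
    and "\<And>k. j \<le> k \<Longrightarrow> k \<le> j + m \<Longrightarrow> F' k = G (k + 1) * F k * H k"
    and "\<And>k. j \<le> k \<Longrightarrow> k \<le> j + m + 1 \<Longrightarrow> G k \<in> carrier_mat (d k) (d k) \<and> H k \<in> carrier_mat (d k) (d k) \<and> H k * G k = 1\<^sub>m (d k)"
  shows "chain F j m \<in> carrier_mat (d (j + m + 1)) (d j) \<and> chain F' j m = G (j + m + 1) * chain F j m * H j"
  using assms
proof (induction m)
  case 0
  then show ?case by simp
next
  case (Suc m)
  let ?k = "j + m + 1"
  have C: "chain F j m \<in> carrier_mat (d ?k) (d j)" and eq: "chain F' j m = G ?k * chain F j m * H j"
    using Suc by auto
  have F: "F ?k \<in> carrier_mat (d (?k + 1)) (d ?k)" using Suc.prems(1)[of ?k] by simp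
  have F': "F' ?k = G (?k + 1) * F ?k * H ?k" using Suc.prems(2)[of ?k] by simp
  have G: "G ?k \<in> carrier_mat (d ?k) (d ?k)" "H ?k \<in> carrier_mat (d ?k) (d ?k)" "H ?k * G ?k = 1\<^sub>m (d ?k)"
    "G (?k + 1) \<in> carrier_mat (d (?k + 1)) (d (?k + 1))" "H j \<in> carrier_mat (d j) (d j)"
    using Suc.prems(3)[of ?k] Suc.prems(3)[of "?k + 1"] Suc.prems(3)[of j] by auto
  have "F' ?k * chain F' j m = G (?k + 1) * (F ?k * chain F j m) * H j"
    unfolding F' eq by (rule conj_mult_mat[OF F C]) (use G in auto)
  then show ?case using C F by simp
qed

lemma SSp_D:
  assumes "(g, h) \<in> SSp n \<alpha>" "1 \<le> i" "i \<le> n"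
  shows "g i \<in> carrier_mat (\<alpha> i) (\<alpha> i)" "h i \<in> carrier_mat (\<alpha> i) (\<alpha> i)"
    "g i * h i = 1\<^sub>m (\<alpha> i)" "h i * g i = 1\<^sub>m (\<alpha> i)" "det (g i) = 1" "det (h i) = 1"
proof -
  show *: "g i \<in> carrier_mat (\<alpha> i) (\<alpha> i)" "h i \<in> carrier_mat (\<alpha> i) (\<alpha> i)"
    "g i * h i = 1\<^sub>m (\<alpha> i)" "h i * g i = 1\<^sub>m (\<alpha> i)" "det (g i) = 1"
    using assms unfolding SSp_def by auto
  show "det (h i) = 1" using det_mult[OF *(1,2)] * by simp
qed

lemma act_SpRep:
  assumes n: "n \<ge> 1" and V: "V \<in> SpRep n \<alpha>" and gh: "(g, h) \<in> SSp n \<alpha>"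
  shows "act n g h V \<in> SpRep n \<alpha>"
  unfolding SpRep_iff[OF n]
proof (intro conjI allI impI)
  fix i assume i: "1 \<le> i \<and> i \<le> n"
  then have Vi: "V i \<in> carrier_mat (tgt_dim n \<alpha> i) (\<alpha> i)" using SpRep_carrier[OF V] by auto
  show "act n g h V i \<in> carrier_mat (tgt_dim n \<alpha> i) (\<alpha> i)"
    using Vi SSp_D(1,2)[OF gh, of i] SSp_D(1,2)[OF gh, of "i + 1"] i
    by (cases "i = n") (auto simp: act_def tgt_dim_def)
next
  have Vn: "V n \<in> carrier_mat (\<alpha> n) (\<alpha> n)" "transpose_mat (V n) = V n" using V by (auto simp: SpRep_def)
  have h: "h n \<in> carrier_mat (\<alpha> n) (\<alpha> n)" using SSp_D(2)[OF gh] n by auto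
  have "transpose_mat (transpose_mat (h n) * V n * h n) = transpose_mat (h n) * (V n * h n)"
    using Vn h by (subst transpose_mult[of _ "\<alpha> n" "\<alpha> n" _ "\<alpha> n"], auto, subst transpose_mult[of _ "\<alpha> n" "\<alpha> n" _ "\<alpha> n"], auto)
  also have "\<dots> = transpose_mat (h n) * V n * h n" using Vn h by (simp add: assoc_mult_mat[of _ "\<alpha> n" "\<alpha> n" _ "\<alpha> n" _ "\<alpha> n"])
  finally show "transpose_mat (act n g h V n) = act n g h V n" by (simp add: act_def)
qed

lemma SpSI_iff:
  "f \<in> SpSI n \<alpha> \<longleftrightarrow> poly_on_rep n \<alpha> f \<and>
     (\<forall>V g h. V \<in> SpRep n \<alpha> \<longrightarrow> (g, h) \<in> SSp n \<alpha> \<longrightarrow> f (act n g h V) = f V)"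
  unfolding SpSI_def poly_on_rep_def by auto

lemma SpSI_const: "(\<lambda>V. c) \<in> SpSI n \<alpha>"
  by (simp add: SpSI_iff poly_on_rep_const)

lemma SpSI_add: "f \<in> SpSI n \<alpha> \<Longrightarrow> g \<in> SpSI n \<alpha> \<Longrightarrow> (\<lambda>V. f V + g V) \<in> SpSI n \<alpha>"
  by (simp add: SpSI_iff poly_on_rep_add)

lemma SpSI_mult: "f \<in> SpSI n \<alpha> \<Longrightarrow> g \<in> SpSI n \<alpha> \<Longrightarrow> (\<lambda>V. f V * g V) \<in> SpSI n \<alpha>"
  by (simp add: SpSI_iff poly_on_rep_mult)

lemma gen_alg_SpSI:
  assumes "G \<subseteq> SpSI n \<alpha>" "p \<in> gen_alg G"
  shows "p \<in> SpSI n \<alpha>"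
  using assms(2,1) by induction (auto intro: SpSI_const SpSI_add SpSI_mult)

lemma det_conj:
  fixes A :: "'a::comm_ring_1 mat"
  assumes "A \<in> carrier_mat d d" "C \<in> carrier_mat d d" "B \<in> carrier_mat d d" "det A = 1" "det B = 1"
  shows "det (A * C * B) = det C"
  using assms by (simp add: det_mult[of _ d])

lemma gens_i_SpSI: "gens_i n \<alpha> \<subseteq> (SpSI n \<alpha> :: ((nat \<Rightarrow> 'k::field mat) \<Rightarrow> 'k) set)"
proof
  fix f :: "(nat \<Rightarrow> 'k mat) \<Rightarrow> 'k" assume "f \<in> gens_i n \<alpha>"
  then obtain i j where f: "f = (\<lambda>V. det (chain V j (i - j)))" and
    ij: "1 \<le> j" "j \<le> i" "i \<le> n - 1" "\<alpha> j = \<alpha> (i + 1)"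
    unfolding gens_i_def by auto
  have in1: "i + 1 \<le> n" using ij by auto
  have eq: "j + (i - j) = i" using ij by simp
  show "f \<in> SpSI n \<alpha>"
    unfolding SpSI_iff
  proof (intro conjI allI impI)
    have "poly_mat n \<alpha> (\<alpha> (j + (i - j) + 1)) (\<alpha> j) (\<lambda>V :: nat \<Rightarrow> 'k mat. chain V j (i - j))"
    proof (rule poly_mat_chain)
      fix k assume "j \<le> k" "k \<le> j + (i - j)"
      then show "poly_mat n \<alpha> (\<alpha> (k + 1)) (\<alpha> k) (\<lambda>V :: nat \<Rightarrow> 'k mat. V k)"
        using poly_mat_arrow[of k n \<alpha>] ij in1 by (simp add: tgt_dim_def)
    qed
    then show "poly_on_rep n \<alpha> f" unfolding f using ij(4) eq by (intro poly_on_rep_det[of _ _ "\<alpha> j"]) simp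
  next
    fix V g h :: "nat \<Rightarrow> 'k mat" assume V: "(V :: nat \<Rightarrow> 'k mat) \<in> SpRep n \<alpha>" and gh: "(g, h) \<in> SSp n \<alpha>"
    have "chain V j (i - j) \<in> carrier_mat (\<alpha> (j + (i - j) + 1)) (\<alpha> j) \<and>
      chain (act n g h V) j (i - j) = g (j + (i - j) + 1) * chain V j (i - j) * h j"
    proof (rule chain_conj)
      fix k assume "j \<le> k" "k \<le> j + (i - j)"
      then have k: "1 \<le> k" "k < n" using ij in1 by auto
      show "V k \<in> carrier_mat (\<alpha> (k + 1)) (\<alpha> k)"
        using SpRep_carrier[OF V, of k] k by (simp add: tgt_dim_def)
      show "act n g h V k = g (k + 1) * V k * h k" using k by (simp add: act_def)
    next
      fix k assume "j \<le> k" "k \<le> j + (i - j) + 1"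
      then have k: "1 \<le> k" "k \<le> n" using ij in1 by auto
      then show "g k \<in> carrier_mat (\<alpha> k) (\<alpha> k) \<and> h k \<in> carrier_mat (\<alpha> k) (\<alpha> k) \<and> h k * g k = 1\<^sub>m (\<alpha> k)"
        using SSp_D[OF gh k] by auto
    qed
    moreover have "1 \<le> j" "j \<le> n" "1 \<le> i + 1" using ij in1 by auto
    ultimately show "f (act n g h V) = f V"
      unfolding f using SSp_D[OF gh, of j] SSp_D[OF gh, of "i + 1"] in1 ij(4) eq
      by (auto intro!: det_conj[of _ "\<alpha> j"])
  qed
qed

lemma gens_ii_SpSI: "gens_ii n \<alpha> \<subseteq> (SpSI n \<alpha> :: ((nat \<Rightarrow> 'k::field mat) \<Rightarrow> 'k) set)"
proof
  fix f :: "(nat \<Rightarrow> 'k mat) \<Rightarrow> 'k" assume "f \<in> gens_ii n \<alpha>"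
  then obtain i where f: "f = (\<lambda>V. det (chain (full_map n V) i (2 * n - 2 * i)))" and i: "1 \<le> i" "i \<le> n"
    unfolding gens_ii_def by auto
  define m where "m = 2 * n - 2 * i"
  \<comment> \<open>The dimension vector of the whole quiver. Vertex \<open>k > n\<close> is the
    mirror image of vertex \<open>2 * n + 1 - k\<close>, whereas arrow \<open>k > n\<close> is the
    mirror image of arrow \<open>2 * n - k\<close>; \<open>mirror\<close> reconciles this shift by
    one.\<close>
  define d where "d k = (if k \<le> n then \<alpha> k else \<alpha> (2 * n + 1 - k))" for k
  have im: "i + m = 2 * n - i" unfolding m_def using i by auto
  have n: "n \<ge> 1" using i by simp
  have di: "d i = \<alpha> i" "d (i + m + 1) = \<alpha> i" unfolding d_def im using i by auto
  have mirror: "1 \<le> 2 * n - k" "2 * n - k < n" "d k = \<alpha> (2 * n - k + 1)" "d (k + 1) = \<alpha> (2 * n - k)"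
    if "n < k" "k \<le> 2 * n - i" for k
  proof -
    show "1 \<le> 2 * n - k" "2 * n - k < n" using that i by auto
    have "2 * n + 1 - k = 2 * n - k + 1" "2 * n + 1 - (k + 1) = 2 * n - k" using that by auto
    then show "d k = \<alpha> (2 * n - k + 1)" "d (k + 1) = \<alpha> (2 * n - k)" using that unfolding d_def by auto
  qed
  show "f \<in> SpSI n \<alpha>"
    unfolding SpSI_iff
  proof (intro conjI allI impI)
    have "poly_mat n \<alpha> (d (i + m + 1)) (d i) (\<lambda>V :: nat \<Rightarrow> 'k mat. chain (full_map n V) i m)"
    proof (rule poly_mat_chain)
      fix k assume k: "i \<le> k" "k \<le> i + m"
      show "poly_mat n \<alpha> (d (k + 1)) (d k) (\<lambda>V :: nat \<Rightarrow> 'k mat. full_map n V k)"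
      proof (cases "k \<le> n")
        case True
        then have "tgt_dim n \<alpha> k = d (k + 1)" "d k = \<alpha> k"
          by (cases "k = n"; simp add: tgt_dim_def d_def)+
        then show ?thesis using poly_mat_arrow[of k n \<alpha>] k i True by (simp add: full_map_def)
      next
        case False
        then have k': "n < k" "k \<le> 2 * n - i" using k im by auto
        then have "poly_mat n \<alpha> (d k) (d (k + 1)) (\<lambda>V :: nat \<Rightarrow> 'k mat. V (2 * n - k))"
          using poly_mat_arrow[of "2 * n - k" n \<alpha>] mirror[OF k'] by (simp add: tgt_dim_def)
        from poly_mat_uminus_transpose[OF this] show ?thesis using False by (simp add: full_map_def)
      qed
    qed
    then show "poly_on_rep n \<alpha> f"
      unfolding f m_def[symmetric] di by (intro poly_on_rep_det)
  next
    fix V g h :: "nat \<Rightarrow> 'k mat" assume V: "(V :: nat \<Rightarrow> 'k mat) \<in> SpRep n \<alpha>" and gh: "(g, h) \<in> SSp n \<alpha>"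
    \<comment> \<open>The group acts at the dual vertices by inverse transposes. With these
      \<open>G\<close> and \<open>H\<close> both formulas in \<open>act\<close> become one
      conjugation along the full path, since \<open>G (n + 1)\<close> is the transpose of
      \<open>h n\<close>.\<close>
    define G where "G k = (if k \<le> n then g k else transpose_mat (h (2 * n + 1 - k)))" for k
    define H where "H k = (if k \<le> n then h k else transpose_mat (g (2 * n + 1 - k)))" for k
    have chain: "chain (full_map n V) i m \<in> carrier_mat (d (i + m + 1)) (d i) \<and>
      chain (full_map n (act n g h V)) i m = G (i + m + 1) * chain (full_map n V) i m * H i"
    proof (rule chain_conj)
      fix k assume k: "i \<le> k" "k \<le> i + m"
      have *: "full_map n V k \<in> carrier_mat (d (k + 1)) (d k) \<and>
        full_map n (act n g h V) k = G (k + 1) * full_map n V k * H k"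
      proof (cases "k \<le> n")
        case True
        then have "tgt_dim n \<alpha> k = d (k + 1)" "d k = \<alpha> k"
          by (cases "k = n"; simp add: tgt_dim_def d_def)+
        then have "full_map n V k \<in> carrier_mat (d (k + 1)) (d k)"
          using SpRep_carrier[OF V, of k] k i True by (simp add: full_map_def)
        moreover have "full_map n (act n g h V) k = G (k + 1) * full_map n V k * H k"
          using True k i by (cases "k = n") (auto simp: full_map_def act_def G_def H_def)
        ultimately show ?thesis by simp
      next
        case False
        then have k': "n < k" "k \<le> 2 * n - i" using k im by auto
        note r = mirror[OF k']
        let ?k = "2 * n - k"
        have Vk: "V ?k \<in> carrier_mat (\<alpha> (?k + 1)) (\<alpha> ?k)"
          using SpRep_carrier[OF V, of ?k] r by (simp add: tgt_dim_def)
        have gg: "g (?k + 1) \<in> carrier_mat (\<alpha> (?k + 1)) (\<alpha> (?k + 1))" "h ?k \<in> carrier_mat (\<alpha> ?k) (\<alpha> ?k)"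
          using SSp_D[OF gh, of "?k + 1"] SSp_D[OF gh, of ?k] r by auto
        have idx: "2 * n + 1 - k = ?k + 1" "2 * n + 1 - (k + 1) = ?k" using k' by auto
        have "transpose_mat (g (?k + 1) * V ?k * h ?k) =
          transpose_mat (h ?k) * (transpose_mat (V ?k) * transpose_mat (g (?k + 1)))"
          using Vk gg by (simp add: transpose_mult[of _ "\<alpha> (?k + 1)" "\<alpha> ?k" _ "\<alpha> ?k"]
            transpose_mult[of _ "\<alpha> (?k + 1)" "\<alpha> (?k + 1)" _ "\<alpha> ?k"])
        also have "\<dots> = transpose_mat (h ?k) * transpose_mat (V ?k) * transpose_mat (g (?k + 1))"
          by (rule assoc_mult_mat[symmetric, of _ "\<alpha> ?k" "\<alpha> ?k" _ "\<alpha> (?k + 1)" _ "\<alpha> (?k + 1)"]) (use Vk gg in auto)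
        also have "- \<dots> = transpose_mat (h ?k) * (- transpose_mat (V ?k)) * transpose_mat (g (?k + 1))"
          using Vk gg by (auto simp del: transpose_mult)
        finally have "full_map n (act n g h V) k = G (k + 1) * full_map n V k * H k"
          using False r k' idx by (simp add: full_map_def act_def G_def H_def)
        then show ?thesis using Vk r False by (simp add: full_map_def)
      qed
      show "full_map n V k \<in> carrier_mat (d (k + 1)) (d k)" using * by simp
      show "full_map n (act n g h V) k = G (k + 1) * full_map n V k * H k" using * by simp
    next
      fix k assume k: "i \<le> k" "k \<le> i + m + 1"
      show "G k \<in> carrier_mat (d k) (d k) \<and> H k \<in> carrier_mat (d k) (d k) \<and> H k * G k = 1\<^sub>m (d k)"
      proof (cases "k \<le> n")
        case True
        then show ?thesis using SSp_D[OF gh, of k] k i by (auto simp: G_def H_def d_def)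
      next
        case False
        let ?k = "2 * n + 1 - k"
        have "1 \<le> ?k" "?k \<le> n" using k im i False by auto
        note s = SSp_D[OF gh this]
        have "transpose_mat (g ?k) * transpose_mat (h ?k) = transpose_mat (h ?k * g ?k)"
          by (rule transpose_mult[symmetric]) (use s in auto)
        then show ?thesis using s False by (auto simp: G_def H_def d_def)
      qed
    qed
    have G: "G (i + m + 1) = transpose_mat (h i)" "H i = h i"
      using i unfolding G_def H_def im by auto
    note s = SSp_D[OF gh i]
    show "f (act n g h V) = f V"
      unfolding f m_def[symmetric] using chain s unfolding G di
      by (auto intro!: det_conj[of _ "\<alpha> i"] simp: det_transpose)
  qed
qed

subsection \<open>Torus-invariant monomials\<close>

text \<open>Torus weights: at vertex \<open>n\<close> the group acts on both sides of the form \<open>V n\<close>, hence the factor 2.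
  A monomial in diagonal entries is invariant under the torus of the special linear group at a vertex iff its
  weight does not depend on the row, which is \<open>balanced\<close>.\<close>
definition vertex_mult :: "nat \<Rightarrow> nat \<Rightarrow> nat" where
  "vertex_mult n i = (if i = n then 2 else 1)"

definition supported :: "nat \<Rightarrow> (nat \<Rightarrow> nat) \<Rightarrow> (nat \<Rightarrow> nat \<Rightarrow> nat) \<Rightarrow> bool" where
  "supported n \<alpha> m \<longleftrightarrow> (\<forall>i r. \<not> (1 \<le> i \<and> i \<le> n \<and> r < min_dim n \<alpha> i) \<longrightarrow> m i r = 0)"

definition balanced :: "nat \<Rightarrow> (nat \<Rightarrow> nat) \<Rightarrow> (nat \<Rightarrow> nat \<Rightarrow> nat) \<Rightarrow> bool" where
  "balanced n \<alpha> m \<longleftrightarrow> (\<forall>i r s. 1 \<le> i \<longrightarrow> i \<le> n \<longrightarrow> r < \<alpha> i \<longrightarrow> s < \<alpha> i \<longrightarrow>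
     m (i - 1) r + vertex_mult n i * m i s = m (i - 1) s + vertex_mult n i * m i r)"

lemma supportedD:
  assumes "supported n \<alpha> m" "m i r \<noteq> 0"
  shows "1 \<le> i" "i \<le> n" "r < \<alpha> i" "i < n \<Longrightarrow> r < \<alpha> (i + 1)"
proof -
  have "1 \<le> i \<and> i \<le> n \<and> r < min_dim n \<alpha> i" 
    using assms(1)[unfolded supported_def, rule_format, of i r] assms(2) by argo
  then show "1 \<le> i" "i \<le> n" "r < \<alpha> i" "i < n \<Longrightarrow> r < \<alpha> (i + 1)"
    by (auto simp: min_dim_def tgt_dim_def)
qed

text \<open>By balance, the difference between the exponents in rows \<open>r\<close> and
  \<open>s\<close> is the same before and after a vertex, up to the factor
  \<open>vertex_mult\<close>. It starts at 0 on the fictitious arrow 0, where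
  \<open>supported\<close> forces exponent 0; and where row \<open>s\<close> has exponent 0 there is
  nothing to prove.\<close>

lemma balanced_decreasing:
  assumes sup: "supported n \<alpha> m" and bal: "balanced n \<alpha> m" and "r \<le> s"
  shows "m i s \<le> m i r"
proof (induction i)
  case 0
  then show ?case using sup unfolding supported_def by simp
next
  case (Suc i)
  show ?case
  proof (cases "m (Suc i) s = 0")
    case False
    note D = supportedD[OF sup False]
    have "r < \<alpha> (Suc i)" using D(3) \<open>r \<le> s\<close> by simp
    then have "m i r + vertex_mult n (Suc i) * m (Suc i) s = m i s + vertex_mult n (Suc i) * m (Suc i) r"
      using bal[unfolded balanced_def, rule_format, of "Suc i" r s] D(1-3) by simp
    then have "vertex_mult n (Suc i) * m (Suc i) s \<le> vertex_mult n (Suc i) * m (Suc i) r"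
      using Suc.IH by linarith
    then show ?thesis by (simp add: vertex_mult_def split: if_splits)
  qed simp
qed

context
  fixes n :: nat and \<alpha> :: "nat \<Rightarrow> nat" and m :: "nat \<Rightarrow> nat \<Rightarrow> nat" and s :: nat
  assumes sup: "supported n \<alpha> m" and bal: "balanced n \<alpha> m"
    and top: "\<And>k. m k (Suc s) = 0"
begin

text \<open>The empty row \<open>Suc s\<close> has weight 0 at every vertex where it exists. By
  balance row \<open>s\<close> has weight 0 there as well: what enters along arrow
  \<open>v - 1\<close> leaves along arrow \<open>v\<close>.\<close>

lemma top_level_step:
  assumes "1 \<le> v" "v \<le> n" "Suc s < \<alpha> v"
  shows "m (v - 1) s = vertex_mult n v * m v s"
proof -
  have "m (v - 1) s + vertex_mult n v * m v (Suc s) = m (v - 1) (Suc s) + vertex_mult n v * m v s"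
    using bal assms unfolding balanced_def by simp
  then show ?thesis using top by simp
qed

text \<open>Walking left from arrow \<open>k\<close>, a nonzero exponent passes every vertex of
  dimension above \<open>Suc s\<close>. It cannot reach arrow 0, so the walk stops, and it can stop
  only at dimension exactly \<open>Suc s\<close>. A factor 2 is collected only at the start, when
  \<open>k\<close> is the form.\<close>

lemma top_level_left:
  assumes "m k s \<noteq> 0"
  shows "\<exists>j. 1 \<le> j \<and> j \<le> k \<and> \<alpha> j = Suc s \<and> (\<forall>v. j < v \<and> v \<le> k \<longrightarrow> Suc s < \<alpha> v) \<and>
    (\<forall>k'. j \<le> k' \<and> k' < k \<longrightarrow> m k' s = vertex_mult n k * m k s)"
  using assms
proof (induction k)
  case 0
  then show ?case using supportedD(1)[OF sup] by fastforce
next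
  case (Suc k)
  note D = supportedD[OF sup Suc.prems]
  show ?case
  proof (cases "\<alpha> (Suc k) = Suc s")
    case True
    then show ?thesis by (intro exI[of _ "Suc k"]) auto
  next
    case False
    then have gt: "Suc s < \<alpha> (Suc k)" using D(3) by simp
    then have mk: "m k s = vertex_mult n (Suc k) * m (Suc k) s"
      using top_level_step[of "Suc k"] D by simp
    then have "m k s \<noteq> 0" using Suc.prems by (simp add: vertex_mult_def)
    from Suc.IH[OF this] obtain j where j: "1 \<le> j" "j \<le> k" "\<alpha> j = Suc s"
      "\<forall>v. j < v \<and> v \<le> k \<longrightarrow> Suc s < \<alpha> v"
      "\<forall>k'. j \<le> k' \<and> k' < k \<longrightarrow> m k' s = vertex_mult n k * m k s" by blast
    have "vertex_mult n k = 1" using D(2) by (simp add: vertex_mult_def)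
    then have "m k' s = vertex_mult n (Suc k) * m (Suc k) s" if "j \<le> k'" "k' < Suc k" for k'
      using that j(5) mk by (cases "k' = k") auto
    moreover have "Suc s < \<alpha> v" if "j < v" "v \<le> Suc k" for v
      using that j(4) gt by (cases "v = Suc k") auto
    ultimately show ?thesis using j(1-3) by (intro exI[of _ j]) auto
  qed
qed

text \<open>The walk to the right, stopped before the form by \<open>m n s = 0\<close>. Recording
  nonvanishing suffices, since a generator that avoids the form has exponents 1.\<close>

lemma top_level_right:
  assumes "m n s = 0" "m k s \<noteq> 0"
  shows "\<exists>i. k \<le> i \<and> i < n \<and> \<alpha> (i + 1) = Suc s \<and> (\<forall>v. k < v \<and> v \<le> i \<longrightarrow> Suc s < \<alpha> v) \<and>
    (\<forall>k'. k \<le> k' \<and> k' \<le> i \<longrightarrow> m k' s \<noteq> 0)"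
  using assms(2)
proof (induction "n - k" arbitrary: k rule: less_induct)
  case less
  note D = supportedD[OF sup less.prems]
  have kn: "k < n" using D(2) assms(1) less.prems by (cases "k = n") auto
  show ?case
  proof (cases "\<alpha> (k + 1) = Suc s")
    case True
    then show ?thesis using kn less.prems by (intro exI[of _ k]) (auto simp: le_antisym)
  next
    case False
    then have gt: "Suc s < \<alpha> (k + 1)" using D(4)[OF kn] by simp
    then have "m k s = vertex_mult n (k + 1) * m (k + 1) s" using top_level_step[of "k + 1"] kn by simp
    then have "m (k + 1) s \<noteq> 0" using less.prems by (metis mult_0_right)
    moreover have "n - (k + 1) < n - k" using kn by simp
    ultimately obtain i where i: "k + 1 \<le> i" "i < n" "\<alpha> (i + 1) = Suc s"
      "\<forall>v. k + 1 < v \<and> v \<le> i \<longrightarrow> Suc s < \<alpha> v" "\<forall>k'. k + 1 \<le> k' \<and> k' \<le> i \<longrightarrow> m k' s \<noteq> 0"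
      using less.hyps[of "k + 1"] by blast
    have "Suc s < \<alpha> v" if "k < v" "v \<le> i" for v
      using that i(4) gt by (cases "v = k + 1") auto
    moreover have "m k' s \<noteq> 0" if "k \<le> k'" "k' \<le> i" for k'
      using that i(5) less.prems by (cases "k' = k") auto
    ultimately show ?thesis using i by (intro exI[of _ i]) auto
  qed
qed

end

text \<open>The exponents of the restriction of a generator to diagonal representations: all diagonal
  entries in the first \<open>N\<close> rows of the arrows \<open>j, \<dots>, i\<close>. For \<open>i = n\<close> the arrows before the form
  occur twice.\<close>
definition gen_exp :: "nat \<Rightarrow> nat \<Rightarrow> nat \<Rightarrow> nat \<Rightarrow> nat \<Rightarrow> nat \<Rightarrow> nat" where
  "gen_exp n j i N k r =
     (if j \<le> k \<and> k \<le> i \<and> r < N then (if i = n \<and> k < n then 2 else 1) else 0)"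

text \<open>Both families in one condition: for \<open>i < n\<close> a path between two vertices of
  equal dimension, for \<open>i = n\<close> the first half of a path from \<open>j\<close> through
  the form to the dual of \<open>j\<close>.\<close>

definition gen_range :: "nat \<Rightarrow> (nat \<Rightarrow> nat) \<Rightarrow> nat \<Rightarrow> nat \<Rightarrow> bool" where
  "gen_range n \<alpha> j i \<longleftrightarrow> 1 \<le> j \<and> j \<le> i \<and> i \<le> n \<and> (\<forall>v. j < v \<and> v \<le> i \<longrightarrow> \<alpha> j < \<alpha> v) \<and>
     (i < n \<longrightarrow> \<alpha> j = \<alpha> (i + 1))"

lemma gen_range_min_dim:
  assumes "gen_range n \<alpha> j i" "j \<le> k" "k \<le> i"
  shows "\<alpha> j \<le> min_dim n \<alpha> k"
proof -
  have "\<alpha> j \<le> \<alpha> v" if "j \<le> v" "v \<le> i" for v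
    using assms that unfolding gen_range_def by (cases "v = j") (auto simp: less_imp_le)
  moreover have "\<alpha> j \<le> \<alpha> (i + 1)" if "i < n" using assms that unfolding gen_range_def by simp
  ultimately show ?thesis
    using assms unfolding min_dim_def tgt_dim_def gen_range_def by (cases "k = i") auto
qed

text \<open>Inside the interval the weights of all rows are 0; at vertex \<open>n\<close> the
  exponent 2 before the form matches \<open>vertex_mult n n = 2\<close> times the exponent 1 of the
  form. At the ends of the interval the dimension is \<open>\<alpha> j\<close>, so all rows have the
  same weight.\<close>

lemma balanced_gen_exp:
  assumes "gen_range n \<alpha> j i"
  shows "balanced n \<alpha> (gen_exp n j i (\<alpha> j))"
  unfolding balanced_def
proof (intro allI impI)
  fix v r s assume v: "1 \<le> v" "v \<le> n" and rs: "r < \<alpha> v" "s < \<alpha> v"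
  note g = assms[unfolded gen_range_def]
  consider "v < j" | "v = j" | "j < v" "v \<le> i" | "v = i + 1" | "v > i + 1" using g by linarith
  then show "gen_exp n j i (\<alpha> j) (v - 1) r + vertex_mult n v * gen_exp n j i (\<alpha> j) v s =
    gen_exp n j i (\<alpha> j) (v - 1) s + vertex_mult n v * gen_exp n j i (\<alpha> j) v r"
    using v rs g by cases (auto simp: gen_exp_def vertex_mult_def)
qed

text \<open>The last nonzero row \<open>s\<close> determines an interval with
  \<open>\<alpha> j = Suc s\<close>, and by \<open>balanced_decreasing\<close> the rows of smaller
  index have at least the same exponents there. Positivity of \<open>\<alpha> j\<close> excludes the
  empty determinant, whose exponents are all 0.\<close>

lemma exists_gen_exp_le:
  assumes sup: "supported n \<alpha> m" and bal: "balanced n \<alpha> m" and "m k0 s0 \<noteq> 0"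
  shows "\<exists>j i. gen_range n \<alpha> j i \<and> \<alpha> j > 0 \<and> (\<forall>k r. gen_exp n j i (\<alpha> j) k r \<le> m k r)"
proof -
  have bound: "s \<le> (\<Sum>i\<in>{1..n}. \<alpha> i)" if ex: "\<exists>k. m k s \<noteq> 0" for s
  proof -
    obtain k where "m k s \<noteq> 0" using ex by blast
    note D = supportedD[OF sup this]
    then have "\<alpha> k \<le> (\<Sum>i\<in>{1..n}. \<alpha> i)" by (intro member_le_sum) auto
    then show ?thesis using D by simp
  qed
  obtain s where s: "\<exists>k. m k s \<noteq> 0" "\<And>s'. \<exists>k. m k s' \<noteq> 0 \<Longrightarrow> s' \<le> s"
    using Nat.ex_has_greatest_nat[of "\<lambda>s. \<exists>k. m k s \<noteq> 0" s0 "\<Sum>i\<in>{1..n}. \<alpha> i"] bound assms(3) by auto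
  have top: "m k (Suc s) = 0" for k using s(2)[of "Suc s"] by fastforce
  note left = top_level_left[OF sup bal top]
  have *: ?thesis if g: "gen_range n \<alpha> j i" "\<alpha> j = Suc s"
    "\<And>k. j \<le> k \<Longrightarrow> k \<le> i \<Longrightarrow> (if i = n \<and> k < n then 2 else 1) \<le> m k s" for j i
  proof -
    have "gen_exp n j i (\<alpha> j) k r \<le> m k r" for k r
      using g(2) g(3)[of k] balanced_decreasing[OF sup bal, of r s k] by (auto simp: gen_exp_def)
    then show ?thesis using g(1,2) by (intro exI[of _ j] exI[of _ i]) auto
  qed
  show ?thesis
  \<comment> \<open>If row \<open>s\<close> occurs in the form, the interval runs up to the form,
    and balance at vertex \<open>n\<close> supplies the exponent 2 on the arrows before it.
    Otherwise it is closed on the right by a vertex of dimension \<open>Suc s\<close>.\<close>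
  proof (cases "m n s = 0")
    case False
    from left[OF False] obtain j where j: "1 \<le> j" "j \<le> n" "\<alpha> j = Suc s"
      "\<forall>v. j < v \<and> v \<le> n \<longrightarrow> Suc s < \<alpha> v"
      "\<forall>k'. j \<le> k' \<and> k' < n \<longrightarrow> m k' s = vertex_mult n n * m n s" by blast
    show ?thesis
    proof (rule *[of j n])
      show "gen_range n \<alpha> j n" using j by (simp add: gen_range_def)
      show "(if n = n \<and> k < n then 2 else 1) \<le> m k s" if "j \<le> k" "k \<le> n" for k
        using that j(5) False by (cases "k = n") (auto simp: vertex_mult_def)
    qed (use j in auto)
  next
    case True
    obtain k where k: "m k s \<noteq> 0" using s(1) by blast
    from left[OF k] obtain j where j: "1 \<le> j" "j \<le> k" "\<alpha> j = Suc s"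
      "\<forall>v. j < v \<and> v \<le> k \<longrightarrow> Suc s < \<alpha> v"
      "\<forall>k'. j \<le> k' \<and> k' < k \<longrightarrow> m k' s = vertex_mult n k * m k s" by blast
    from top_level_right[OF sup bal top True k] obtain i where i: "k \<le> i" "i < n" "\<alpha> (i + 1) = Suc s"
      "\<forall>v. k < v \<and> v \<le> i \<longrightarrow> Suc s < \<alpha> v" "\<forall>k'. k \<le> k' \<and> k' \<le> i \<longrightarrow> m k' s \<noteq> 0" by blast
    have nz: "m k' s \<noteq> 0" if "j \<le> k'" "k' \<le> i" for k'
      using that i(5) j(5) k by (cases "k' < k") (auto simp: vertex_mult_def)
    have "Suc s < \<alpha> v" if "j < v" "v \<le> i" for v
      using that i(4) j(4) by (cases "v \<le> k") auto
    then have "gen_range n \<alpha> j i" using i j by (auto simp: gen_range_def)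
    then show ?thesis
      by (rule *) (use j i nz in \<open>auto simp: Suc_le_eq\<close>)
  qed
qed

subsection \<open>The diagonal slice\<close>

definition diag_rect :: "nat \<Rightarrow> nat \<Rightarrow> (nat \<Rightarrow> 'k::zero) \<Rightarrow> 'k mat" where
  "diag_rect a b \<tau> = mat a b (\<lambda>(r, s). if r = s then \<tau> r else 0)"

definition diag_rep :: "nat \<Rightarrow> (nat \<Rightarrow> nat) \<Rightarrow> (nat \<Rightarrow> nat \<Rightarrow> 'k::field) \<Rightarrow> nat \<Rightarrow> 'k mat" where
  "diag_rep n \<alpha> t i = diag_rect (tgt_dim n \<alpha> i) (\<alpha> i) (t i)"

lemma diag_rect_carrier [simp]: "diag_rect a b \<tau> \<in> carrier_mat a b"
  by (simp add: diag_rect_def)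

lemma index_diag_rect [simp]:
  "r < a \<Longrightarrow> s < b \<Longrightarrow> diag_rect a b \<tau> $$ (r, s) = (if r = s then \<tau> r else 0)"
  by (simp add: diag_rect_def)

lemma dim_diag_rect [simp]: "dim_row (diag_rect a b \<tau>) = a" "dim_col (diag_rect a b \<tau>) = b"
  by (simp_all add: diag_rect_def)

lemma transpose_diag_rect [simp]: "transpose_mat (diag_rect a b \<tau>) = diag_rect b a \<tau>"
  by (rule eq_matI) auto

lemma uminus_diag_rect:
  fixes \<tau> :: "nat \<Rightarrow> 'k::ring"
  shows "- diag_rect a b \<tau> = diag_rect a b (\<lambda>r. - \<tau> r)"
  by (rule eq_matI) auto

text \<open>A middle dimension of at least \<open>min a c\<close> ensures that no diagonal position
  of the product is lost.\<close>

lemma diag_rect_mult: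
  fixes \<tau> \<upsilon> :: "nat \<Rightarrow> 'k::semiring_0"
  assumes "min a c \<le> b"
  shows "diag_rect a b \<tau> * diag_rect b c \<upsilon> = diag_rect a c (\<lambda>r. \<tau> r * \<upsilon> r)"
proof (rule eq_matI)
  fix r s assume "r < dim_row (diag_rect a c (\<lambda>r. \<tau> r * \<upsilon> r))" "s < dim_col (diag_rect a c (\<lambda>r. \<tau> r * \<upsilon> r))"
  then have rs: "r < a" "s < c" by auto
  have "(diag_rect a b \<tau> * diag_rect b c \<upsilon>) $$ (r, s) =
    (\<Sum>x\<in>{0..<b}. (if r = x then \<tau> r else 0) * (if x = s then \<upsilon> x else 0))"
    using rs by (auto simp: scalar_prod_def intro!: sum.cong)
  also have "\<dots> = (\<Sum>x\<in>{0..<b}. if x = r then (if r = s then \<tau> r * \<upsilon> r else 0) else 0)"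
    by (intro sum.cong) auto
  also have "\<dots> = (if r = s then \<tau> r * \<upsilon> r else 0)" using rs assms by (auto simp: sum.delta')
  finally show "(diag_rect a b \<tau> * diag_rect b c \<upsilon>) $$ (r, s) = diag_rect a c (\<lambda>r. \<tau> r * \<upsilon> r) $$ (r, s)"
    using rs by simp
qed auto

lemma diag_rect_one: "diag_rect a a (\<lambda>_. 1) = 1\<^sub>m a"
  by (rule eq_matI) auto

lemma diag_rect_cong: "(\<And>r. r < min a b \<Longrightarrow> \<tau> r = \<upsilon> r) \<Longrightarrow> diag_rect a b \<tau> = diag_rect a b \<upsilon>"
  by (rule eq_matI) auto

lemma det_diag_rect:
  fixes \<tau> :: "nat \<Rightarrow> 'k::comm_ring_1"
  shows "det (diag_rect a a \<tau>) = (\<Prod>r<a. \<tau> r)"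
proof -
  have "det (diag_rect a a \<tau>) = (\<Prod>r = 0..<a. diag_rect a a \<tau> $$ (r, r))"
    by (subst det_upper_triangular[of _ a]) (auto simp: prod_list_diag_prod)
  then show ?thesis by (simp add: atLeast0LessThan)
qed

text \<open>Every intermediate space is at least as large as the source, so no diagonal entry is cut
  off on the way.\<close>

lemma chain_diag_rect:
  assumes "\<And>k. j \<le> k \<Longrightarrow> k \<le> j + m \<Longrightarrow> F k = diag_rect (d (k + 1)) (d k) (\<tau> k)"
    and "\<And>k. j \<le> k \<Longrightarrow> k \<le> j + m \<Longrightarrow> d j \<le> d k"
  shows "chain F j m = diag_rect (d (j + m + 1)) (d j) (\<lambda>r. \<Prod>k\<in>{j..j + m}. \<tau> k r)"
  using assms
proof (induction m)
  case 0
  then show ?case by simp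
next
  case (Suc m)
  have "chain F j m = diag_rect (d (j + m + 1)) (d j) (\<lambda>r. \<Prod>k\<in>{j..j + m}. \<tau> k r)"
    using Suc.prems by (intro Suc.IH) auto
  moreover have "F (j + Suc m) = diag_rect (d (j + Suc m + 1)) (d (j + m + 1)) (\<tau> (j + Suc m))"
    using Suc.prems(1)[of "j + Suc m"] by simp
  moreover have "d j \<le> d (j + m + 1)" using Suc.prems(2)[of "j + m + 1"] by simp
  ultimately show ?case by (simp add: diag_rect_mult mult.commute)
qed

lemma diag_rep_SpRep: "n \<ge> 1 \<Longrightarrow> diag_rep n \<alpha> t \<in> SpRep n \<alpha>"
  by (auto simp: SpRep_iff diag_rep_def tgt_dim_def)

section \<open>Generators restricted to the slice\<close>

definition diag_monom :: "nat \<Rightarrow> (nat \<Rightarrow> nat) \<Rightarrow> (nat \<Rightarrow> nat \<Rightarrow> nat) \<Rightarrow> (nat \<Rightarrow> nat \<Rightarrow> 'k::field) \<Rightarrow> 'k" where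
  "diag_monom n \<alpha> m t = (\<Prod>i\<in>{1..n}. \<Prod>r<min_dim n \<alpha> i. t i r ^ m i r)"

lemma diag_monom_add: "diag_monom n \<alpha> (\<lambda>i r. m i r + m' i r) t = diag_monom n \<alpha> m t * diag_monom n \<alpha> m' t"
  by (simp add: diag_monom_def power_add prod.distrib)

lemma diag_monom_gen_exp:
  assumes g: "gen_range n \<alpha> j i"
  shows "diag_monom n \<alpha> (gen_exp n j i (\<alpha> j)) t =
    (\<Prod>r<\<alpha> j. \<Prod>k\<in>{j..i}. t k r ^ (if i = n \<and> k < n then 2 else 1))"
proof -
  have "diag_monom n \<alpha> (gen_exp n j i (\<alpha> j)) t =
    (\<Prod>k\<in>{j..i}. \<Prod>r<min_dim n \<alpha> k. t k r ^ gen_exp n j i (\<alpha> j) k r)"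
    unfolding diag_monom_def using g
    by (intro prod.mono_neutral_right) (auto simp: gen_range_def gen_exp_def)
  also have "\<dots> = (\<Prod>k\<in>{j..i}. \<Prod>r<\<alpha> j. t k r ^ (if i = n \<and> k < n then 2 else 1))"
  proof (rule prod.cong[OF refl])
    fix k assume "k \<in> {j..i}"
    then show "(\<Prod>r<min_dim n \<alpha> k. t k r ^ gen_exp n j i (\<alpha> j) k r) =
      (\<Prod>r<\<alpha> j. t k r ^ (if i = n \<and> k < n then 2 else 1))"
      using gen_range_min_dim[OF g, of k]
      by (intro prod.mono_neutral_cong_right) (auto simp: gen_exp_def)
  qed
  also have "\<dots> = (\<Prod>r<\<alpha> j. \<Prod>k\<in>{j..i}. t k r ^ (if i = n \<and> k < n then 2 else 1))"
    by (rule prod.swap)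
  finally show ?thesis .
qed

lemma gens_i_diag_rep:
  assumes g: "gen_range n \<alpha> j i" and "i < n"
  shows "det (chain (diag_rep n \<alpha> t) j (i - j)) = diag_monom n \<alpha> (gen_exp n j i (\<alpha> j)) t"
proof -
  have ij: "j + (i - j) = i" "\<alpha> (i + 1) = \<alpha> j" "j \<le> i" using assms by (auto simp: gen_range_def)
  have "chain (diag_rep n \<alpha> t) j (i - j) =
    diag_rect (\<alpha> (j + (i - j) + 1)) (\<alpha> j) (\<lambda>r. \<Prod>k\<in>{j..j + (i - j)}. t k r)"
  proof (rule chain_diag_rect)
    fix k assume k: "j \<le> k" "k \<le> j + (i - j)"
    then show "diag_rep n \<alpha> t k = diag_rect (\<alpha> (k + 1)) (\<alpha> k) (t k)"
      using assms(2) ij by (simp add: diag_rep_def tgt_dim_def)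
    show "\<alpha> j \<le> \<alpha> k" using gen_range_min_dim[OF g, of k] k ij by (simp add: min_dim_def)
  qed
  then show ?thesis
    using \<open>i < n\<close> by (simp add: diag_monom_gen_exp[OF g] det_diag_rect ij(1) ij(2)[simplified])
qed

text \<open>Each of the \<open>n - j\<close> arrows before the form occurs once as itself and once
  as a negative transpose. This squares its diagonal entries and contributes one sign in each of the
  \<open>\<alpha> j\<close> rows.\<close>

lemma gens_ii_diag_rep:
  assumes g: "gen_range n \<alpha> j n"
  shows "det (chain (full_map n (diag_rep n \<alpha> t)) j (2 * n - 2 * j)) =
    ((- 1) ^ (n - j)) ^ \<alpha> j * diag_monom n \<alpha> (gen_exp n j n (\<alpha> j)) t"
proof -
  have j: "1 \<le> j" "j \<le> n" using g by (auto simp: gen_range_def)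
  define m where "m = 2 * n - 2 * j"
  have jm: "j + m = 2 * n - j" "2 * n + 1 - (j + m + 1) = j" unfolding m_def using j by auto
  define d where "d k = (if k \<le> n then \<alpha> k else \<alpha> (2 * n + 1 - k))" for k
  define \<tau> where "\<tau> k = (if k \<le> n then t k else (\<lambda>r. - t (2 * n - k) r))" for k
  have d: "d j = \<alpha> j" "d (j + m + 1) = \<alpha> j" using j jm unfolding d_def by auto
  have "chain (full_map n (diag_rep n \<alpha> t)) j m =
    diag_rect (d (j + m + 1)) (d j) (\<lambda>r. \<Prod>k\<in>{j..j + m}. \<tau> k r)"
  proof (rule chain_diag_rect)
    fix k assume k: "j \<le> k" "k \<le> j + m"
    show "full_map n (diag_rep n \<alpha> t) k = diag_rect (d (k + 1)) (d k) (\<tau> k)"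
    proof (cases "k \<le> n")
      case True
      have "tgt_dim n \<alpha> k = d (k + 1)" using True by (cases "k = n") (simp_all add: tgt_dim_def d_def)
      then show ?thesis using True by (simp add: full_map_def diag_rep_def \<tau>_def d_def)
    next
      case False
      have "2 * n + 1 - k = 2 * n - k + 1" using False k jm by simp
      moreover have "2 * n - k \<noteq> n" using False j by arith
      ultimately have "d k = tgt_dim n \<alpha> (2 * n - k)" using False by (simp add: d_def tgt_dim_def)
      moreover have "d (k + 1) = \<alpha> (2 * n - k)" using False by (simp add: d_def)
      ultimately show ?thesis using False by (simp add: full_map_def diag_rep_def \<tau>_def uminus_diag_rect)
    qed
    let ?k = "if k \<le> n then k else 2 * n + 1 - k"
    have "j \<le> ?k" "?k \<le> n" using k j jm by auto
    then have "\<alpha> j \<le> \<alpha> ?k" using gen_range_min_dim[OF g, of ?k] by (simp add: min_dim_def)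
    then show "d j \<le> d k" using j by (simp add: d_def split: if_splits)
  qed
  then have "det (chain (full_map n (diag_rep n \<alpha> t)) j m) = (\<Prod>r<\<alpha> j. \<Prod>k\<in>{j..j + m}. \<tau> k r)"
    by (simp only: d det_diag_rect)
  also have "\<dots> = (\<Prod>r<\<alpha> j. (- 1) ^ (n - j) * (\<Prod>k\<in>{j..n}. t k r ^ (if n = n \<and> k < n then 2 else 1)))"
  proof (rule prod.cong[OF refl])
    fix r
    have split: "{j..j + m} = {j..n} \<union> {n + 1..2 * n - j}" using jm j by auto
    have last: "{j..n} = insert n {j..<n}" using j by auto
    have "(\<Prod>k\<in>{j..j + m}. \<tau> k r) = (\<Prod>k\<in>{j..n}. \<tau> k r) * (\<Prod>k\<in>{n + 1..2 * n - j}. \<tau> k r)"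
      unfolding split by (rule prod.union_disjoint) auto
    also have "(\<Prod>k\<in>{j..n}. \<tau> k r) = t n r * (\<Prod>k\<in>{j..<n}. t k r)"
      unfolding last by (simp add: \<tau>_def)
    also have "(\<Prod>k\<in>{n + 1..2 * n - j}. \<tau> k r) = (\<Prod>k\<in>{j..<n}. - t k r)"
      by (rule prod.reindex_bij_witness[of _ "\<lambda>k. 2 * n - k" "\<lambda>k. 2 * n - k"]) (auto simp: \<tau>_def)
    also have "\<dots> = (- 1) ^ (n - j) * (\<Prod>k\<in>{j..<n}. t k r)" by (simp add: prod_uminus)
    also have "t n r * (\<Prod>k\<in>{j..<n}. t k r) * ((- 1) ^ (n - j) * (\<Prod>k\<in>{j..<n}. t k r)) =
      (- 1) ^ (n - j) * (t n r * (\<Prod>k\<in>{j..<n}. t k r ^ 2))"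
      by (simp add: power2_eq_square prod.distrib)
    also have "t n r * (\<Prod>k\<in>{j..<n}. t k r ^ 2) = (\<Prod>k\<in>{j..n}. t k r ^ (if n = n \<and> k < n then 2 else 1))"
      unfolding last by simp
    finally show "(\<Prod>k\<in>{j..j + m}. \<tau> k r) =
      (- 1) ^ (n - j) * (\<Prod>k\<in>{j..n}. t k r ^ (if n = n \<and> k < n then 2 else 1))" .
  qed
  also have "\<dots> = ((- 1) ^ (n - j)) ^ \<alpha> j * diag_monom n \<alpha> (gen_exp n j n (\<alpha> j)) t"
    unfolding diag_monom_gen_exp[OF g] by (simp add: prod.distrib)
  finally show ?thesis unfolding m_def .
qed

lemma diag_monom_gen_exp_gen_alg:
  assumes g: "gen_range n \<alpha> j i"
  shows "\<exists>p \<in> gen_alg (gens_i n \<alpha> \<union> gens_ii n \<alpha>). \<forall>t :: nat \<Rightarrow> nat \<Rightarrow> 'k::field.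
    diag_monom n \<alpha> (gen_exp n j i (\<alpha> j)) t = p (diag_rep n \<alpha> t)"
proof (cases "i = n")
  case False
  then have "i < n" using g by (simp add: gen_range_def)
  then have "(\<lambda>V :: nat \<Rightarrow> 'k mat. det (chain V j (i - j))) \<in> gens_i n \<alpha>"
    using g unfolding gens_i_def gen_range_def by fastforce
  then show ?thesis
    using gens_i_diag_rep[OF g \<open>i < n\<close>, symmetric] by (intro bexI[OF _ ga_gen]) auto
next
  case True
  note g' = g[unfolded True]
  have "(\<lambda>V :: nat \<Rightarrow> 'k mat. det (chain (full_map n V) j (2 * n - 2 * j))) \<in> gens_ii n \<alpha>"
    using g' unfolding gens_ii_def gen_range_def by blast
  then have "(\<lambda>V :: nat \<Rightarrow> 'k mat. ((- 1) ^ (n - j)) ^ \<alpha> j * det (chain (full_map n V) j (2 * n - 2 * j)))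
    \<in> gen_alg (gens_i n \<alpha> \<union> gens_ii n \<alpha>)"
    by (intro ga_mult ga_const ga_gen) auto
  moreover have "((- 1) ^ (n - j)) ^ \<alpha> j * ((- 1) ^ (n - j)) ^ \<alpha> j = (1 :: 'k)"
    by (simp flip: power_mult_distrib)
  ultimately show ?thesis
    unfolding True by (intro bexI) (auto simp: gens_ii_diag_rep[OF g'] simp flip: mult.assoc)
qed

text \<open>Induction on the total degree: one generator is divided out, and the quotient is again
  balanced because balance is linear in the exponents.\<close>

lemma balanced_diag_monom_gen_alg:
  assumes "supported n \<alpha> m" "balanced n \<alpha> m"
  shows "\<exists>p \<in> gen_alg (gens_i n \<alpha> \<union> gens_ii n \<alpha>). \<forall>t :: nat \<Rightarrow> nat \<Rightarrow> 'k::field.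
    diag_monom n \<alpha> m t = p (diag_rep n \<alpha> t)"
  using assms
proof (induction "\<Sum>i\<in>{1..n}. \<Sum>r<min_dim n \<alpha> i. m i r" arbitrary: m rule: less_induct)
  case less
  show ?case
  proof (cases "\<forall>k r. m k r = 0")
    case True
    then show ?thesis by (intro bexI[OF _ ga_const[of 1]]) (simp add: diag_monom_def)
  next
    case False
    then obtain k0 s0 where nz: "m k0 s0 \<noteq> 0" by blast
    obtain j i where
      g: "gen_range n \<alpha> j i" "\<alpha> j > 0" and le: "\<And>k r. gen_exp n j i (\<alpha> j) k r \<le> m k r"
      using exists_gen_exp_le[OF less.prems nz] by blast
    let ?e = "gen_exp n j i (\<alpha> j)"
    define m' where "m' k r = m k r - ?e k r" for k r
    have m: "m = (\<lambda>k r. ?e k r + m' k r)" using le by (intro ext) (simp add: m'_def)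
    have sup: "supported n \<alpha> m'" using less.prems(1) by (simp add: supported_def m'_def)
    have "balanced n \<alpha> m'"
      unfolding balanced_def
    proof (intro allI impI)
      fix v r s assume v: "1 \<le> v" "v \<le> n" "r < \<alpha> v" "s < \<alpha> v"
      note 1 = less.prems(2)[unfolded balanced_def, rule_format, OF v]
      note 2 = balanced_gen_exp[OF g(1), unfolded balanced_def, rule_format, OF v]
      show "m' (v - 1) r + vertex_mult n v * m' v s = m' (v - 1) s + vertex_mult n v * m' v r"
        using 1 2 unfolding fun_cong[OF fun_cong[OF m]] by (simp add: distrib_left)
    qed
    moreover have "(\<Sum>i\<in>{1..n}. \<Sum>r<min_dim n \<alpha> i. m' i r) < (\<Sum>i\<in>{1..n}. \<Sum>r<min_dim n \<alpha> i. m i r)"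
    proof (rule sum_strict_mono_ex1)
      show "\<forall>k\<in>{1..n}. (\<Sum>r<min_dim n \<alpha> k. m' k r) \<le> (\<Sum>r<min_dim n \<alpha> k. m k r)"
        by (auto intro!: sum_mono simp: m'_def)
      have j: "j \<in> {1..n}" "j \<le> i" using g by (auto simp: gen_range_def)
      have "0 < min_dim n \<alpha> j" using gen_range_min_dim[OF g(1), of j] g(2) j by simp
      moreover have "?e j 0 \<ge> 1" using g(2) j by (auto simp: gen_exp_def)
      then have "m' j 0 < m j 0" using le[of j 0] by (simp add: m'_def)
      ultimately have "(\<Sum>r<min_dim n \<alpha> j. m' j r) < (\<Sum>r<min_dim n \<alpha> j. m j r)"
        by (intro sum_strict_mono_ex1) (auto simp: m'_def intro!: bexI[of _ 0])
      then show "\<exists>k\<in>{1..n}. (\<Sum>r<min_dim n \<alpha> k. m' k r) < (\<Sum>r<min_dim n \<alpha> k. m k r)"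
        using j(1) by blast
    qed simp
    ultimately obtain p where p: "p \<in> gen_alg (gens_i n \<alpha> \<union> gens_ii n \<alpha>)"
      "\<forall>t :: nat \<Rightarrow> nat \<Rightarrow> 'k. diag_monom n \<alpha> m' t = p (diag_rep n \<alpha> t)"
      using less.hyps[OF _ sup] by blast
    obtain q where q: "q \<in> gen_alg (gens_i n \<alpha> \<union> gens_ii n \<alpha>)"
      "\<forall>t :: nat \<Rightarrow> nat \<Rightarrow> 'k. diag_monom n \<alpha> ?e t = q (diag_rep n \<alpha> t)"
      using diag_monom_gen_exp_gen_alg[OF g(1)] by blast
    have "diag_monom n \<alpha> m t = q (diag_rep n \<alpha> t) * p (diag_rep n \<alpha> t)" for t :: "nat \<Rightarrow> nat \<Rightarrow> 'k"
      using p(2) q(2) diag_monom_add[of n \<alpha> ?e m' t] by (simp flip: m)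
    then show ?thesis by (intro bexI[OF _ ga_mult[OF q(1) p(1)]]) simp
  qed
qed

text \<open>Points of \<open>SpRep n \<alpha>\<close> are functions on all natural numbers,
  constrained only at the arrows 1 to \<open>n\<close>. Since \<open>f\<close> is polynomial in
  those entries, representations may be compared arrow by arrow.\<close>

lemma SpSI_cong_arrows:
  fixes V W :: "nat \<Rightarrow> 'k::field mat"
  assumes f: "f \<in> SpSI n \<alpha>" and n: "n \<ge> 1" and "V \<in> SpRep n \<alpha>" "W \<in> SpRep n \<alpha>"
    and eq: "\<And>i. 1 \<le> i \<Longrightarrow> i \<le> n \<Longrightarrow> V i = W i"
  shows "f V = f W"
proof -
  obtain q where q: "q \<in> poly_fun n \<alpha>" "\<forall>V \<in> SpRep n \<alpha>. f V = q V"
    using f unfolding SpSI_def by blast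
  have "q V = q W" using q(1) n by (induction rule: poly_fun_induct') (auto simp: eq)
  then show ?thesis using q(2) assms by simp
qed

section \<open>Torus invariance on the slice\<close>

definition sum_monoms :: "nat \<Rightarrow> (nat \<Rightarrow> nat) \<Rightarrow> ('k \<times> (nat \<Rightarrow> nat \<Rightarrow> nat)) list \<Rightarrow> (nat \<Rightarrow> nat \<Rightarrow> 'k::field) \<Rightarrow> 'k" where
  "sum_monoms n \<alpha> xs t = (\<Sum>x\<leftarrow>xs. fst x * diag_monom n \<alpha> (snd x) t)"

lemma sum_list_product:
  fixes F :: "'a \<Rightarrow> 'b::semiring_0"
  shows "(\<Sum>(x, y)\<leftarrow>List.product xs ys. F x * G y) = (\<Sum>x\<leftarrow>xs. F x) * (\<Sum>y\<leftarrow>ys. G y)"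
  by (induction xs) (simp_all add: o_def sum_list_const_mult distrib_right)

lemma diag_monom_single:
  assumes "1 \<le> i" "i \<le> n" "r < min_dim n \<alpha> i"
  shows "diag_monom n \<alpha> (\<lambda>i' r'. if i' = i \<and> r' = r then 1 else 0) t = t i r"
proof -
  have "(\<Prod>r'<min_dim n \<alpha> i. t i r' ^ (if r' = r then 1 else 0)) =
    (\<Prod>r'<min_dim n \<alpha> i. if r' = r then t i r else 1)"
    by (intro prod.cong) auto
  also have "\<dots> = t i r" using assms by simp
  finally have "diag_monom n \<alpha> (\<lambda>i' r'. if i' = i \<and> r' = r then 1 else 0) t =
    (\<Prod>i'\<in>{1..n}. if i' = i then t i r else 1)"
    unfolding diag_monom_def by (intro prod.cong) auto
  then show ?thesis using assms by simp
qed

text \<open>Off-diagonal coordinates vanish on the slice and give the empty list. The lists may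
  repeat an exponent, as they are only filtered and evaluated.\<close>

lemma poly_fun_diag_rep:
  fixes q :: "(nat \<Rightarrow> 'k::field mat) \<Rightarrow> 'k"
  assumes "q \<in> poly_fun n \<alpha>" "n \<ge> 1"
  shows "\<exists>xs. (\<forall>x\<in>set xs. supported n \<alpha> (snd x)) \<and> (\<forall>t. q (diag_rep n \<alpha> t) = sum_monoms n \<alpha> xs t)"
  using assms
proof (induction rule: poly_fun_induct')
  case (const c)
  show ?case
    by (rule exI[of _ "[(c, \<lambda>_ _. 0)]"]) (simp add: sum_monoms_def diag_monom_def supported_def)
next
  case (coord i r s)
  show ?case
  proof (cases "r = s")
    case True
    then have "r < min_dim n \<alpha> i" using coord by (simp add: min_dim_def)
    then show ?thesis using coord True
      by (intro exI[of _ "[(1, \<lambda>i' r'. if i' = i \<and> r' = r then 1 else 0)]"])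
        (auto simp: sum_monoms_def diag_rep_def supported_def diag_monom_single)
  next
    case False
    then show ?thesis using coord by (intro exI[of _ "[]"]) (simp add: sum_monoms_def diag_rep_def)
  qed
next
  case (add f g)
  then obtain xs ys where "\<forall>x\<in>set xs. supported n \<alpha> (snd x)" "\<forall>t. f (diag_rep n \<alpha> t) = sum_monoms n \<alpha> xs t"
    "\<forall>x\<in>set ys. supported n \<alpha> (snd x)" "\<forall>t. g (diag_rep n \<alpha> t) = sum_monoms n \<alpha> ys t" by blast
  then show ?case by (intro exI[of _ "xs @ ys"]) (auto simp: sum_monoms_def)
next
  case (mult f g)
  then obtain xs ys where xs: "\<forall>x\<in>set xs. supported n \<alpha> (snd x)" "\<forall>t. f (diag_rep n \<alpha> t) = sum_monoms n \<alpha> xs t"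
    and ys: "\<forall>x\<in>set ys. supported n \<alpha> (snd x)" "\<forall>t. g (diag_rep n \<alpha> t) = sum_monoms n \<alpha> ys t" by blast
  let ?zs = "map (\<lambda>(x, y). (fst x * fst y, \<lambda>i r. snd x i r + snd y i r)) (List.product xs ys)"
  have "sum_monoms n \<alpha> ?zs t = sum_monoms n \<alpha> xs t * sum_monoms n \<alpha> ys t" for t
    unfolding sum_monoms_def sum_list_product[symmetric]
    by (simp add: o_def case_prod_unfold diag_monom_add mult_ac)
  moreover have "\<forall>x\<in>set ?zs. supported n \<alpha> (snd x)" using xs(1) ys(1) by (fastforce simp: supported_def)
  ultimately show ?case using xs ys by (intro exI[of _ ?zs]) simp
qed

text \<open>Multiplication by \<open>z ^ N\<close>, with \<open>N\<close> at least every
  \<open>B x\<close>, turns the Laurent sum into a polynomial that agrees with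
  \<open>c * z ^ N\<close> at infinitely many points. The coefficient at \<open>N\<close> collects
  exactly the terms with \<open>A x = B x\<close>.\<close>

lemma sum_list_laurent_const_coeff:
  fixes a :: "'x \<Rightarrow> 'k::field_char_0" and A B :: "'x \<Rightarrow> nat"
  assumes eq: "\<And>z. z \<noteq> 0 \<Longrightarrow> (\<Sum>x\<leftarrow>xs. a x * (z ^ A x * inverse z ^ B x)) = c"
  shows "(\<Sum>x\<leftarrow>filter (\<lambda>x. A x = B x) xs. a x) = c"
proof -
  define N where "N = sum_list (map B xs)"
  have N: "B x \<le> N" if "x \<in> set xs" for x
    using member_le_sum_list[of "B x" "map B xs"] that by (simp add: N_def)
  define p where "p = (\<Sum>x\<leftarrow>xs. monom (a x) (A x + N - B x)) - monom c N"
  have poly_sum: "poly (\<Sum>x\<leftarrow>ys. monom (a x) (A x + N - B x)) z =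
    (\<Sum>x\<leftarrow>ys. a x * z ^ (A x + N - B x))" for ys z
    by (induction ys) (simp_all add: poly_monom)
  have coeff_sum: "coeff (\<Sum>x\<leftarrow>ys. monom (a x) (A x + N - B x)) N =
    (\<Sum>x\<leftarrow>ys. if A x + N - B x = N then a x else 0)" for ys
    by (induction ys) simp_all
  have "poly p z = 0" if z: "z \<noteq> 0" for z
  proof -
    have "(\<Sum>x\<leftarrow>xs. a x * z ^ (A x + N - B x)) = (\<Sum>x\<leftarrow>xs. z ^ N * (a x * (z ^ A x * inverse z ^ B x)))"
    proof (rule arg_cong[where f = sum_list], rule map_cong[OF refl])
      fix x assume "x \<in> set xs"
      then have "z ^ A x * z ^ N = z ^ (A x + N - B x) * z ^ B x"
        using N[of x] by (simp flip: power_add)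
      then show "a x * z ^ (A x + N - B x) = z ^ N * (a x * (z ^ A x * inverse z ^ B x))"
        using z by (simp add: power_inverse field_simps)
    qed
    also have "\<dots> = z ^ N * c" using eq[OF z] by (simp add: sum_list_const_mult)
    finally show ?thesis by (simp add: p_def poly_sum poly_monom)
  qed
  then have "- {0} \<subseteq> {z. poly p z = 0}" by auto
  moreover have "infinite (- {0 :: 'k})" by (simp add: infinite_UNIV_char_0 Compl_eq_Diff_UNIV)
  ultimately have "p = 0" using poly_roots_finite[of p] finite_subset by blast
  then have "coeff p N = 0" by simp
  then have "(\<Sum>x\<leftarrow>xs. if A x + N - B x = N then a x else 0) = c" by (simp add: p_def coeff_sum)
  moreover have "(\<Sum>x\<leftarrow>xs. if A x + N - B x = N then a x else 0) = (\<Sum>x\<leftarrow>xs. if A x = B x then a x else 0)"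
    by (rule arg_cong[where f = sum_list], rule map_cong[OF refl]) (use N in fastforce)
  ultimately show ?thesis by (simp add: sum_list_map_filter')
qed

lemma SpSI_diag_torus:
  fixes f :: "(nat \<Rightarrow> 'k::field mat) \<Rightarrow> 'k"
  assumes f: "f \<in> SpSI n \<alpha>" and n: "n \<ge> 1"
    and uv: "\<And>i r. 1 \<le> i \<Longrightarrow> i \<le> n \<Longrightarrow> r < \<alpha> i \<Longrightarrow> u i r * v i r = 1"
    and u: "\<And>i. 1 \<le> i \<Longrightarrow> i \<le> n \<Longrightarrow> (\<Prod>r<\<alpha> i. u i r) = 1"
  shows "f (diag_rep n \<alpha> (\<lambda>i r. (if i = n then v n r else u (i + 1) r) * t i r * v i r)) = f (diag_rep n \<alpha> t)"
proof -
  define g where "g i = diag_rect (\<alpha> i) (\<alpha> i) (u i)" for i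
  define h where "h i = diag_rect (\<alpha> i) (\<alpha> i) (v i)" for i
  have "diag_rect (\<alpha> i) (\<alpha> i) (\<lambda>r. u i r * v i r) = 1\<^sub>m (\<alpha> i)"
    "diag_rect (\<alpha> i) (\<alpha> i) (\<lambda>r. v i r * u i r) = 1\<^sub>m (\<alpha> i)" if "1 \<le> i" "i \<le> n" for i
    unfolding diag_rect_one[symmetric] using uv[OF that] by (auto intro!: diag_rect_cong simp: mult.commute)
  then have gh: "(g, h) \<in> SSp n \<alpha>"
    unfolding SSp_def g_def h_def using u by (auto simp: diag_rect_mult det_diag_rect)
  have "f (diag_rep n \<alpha> t) = f (act n g h (diag_rep n \<alpha> t))"
    using f gh diag_rep_SpRep[OF n] unfolding SpSI_iff by metis
  also have "\<dots> = f (diag_rep n \<alpha> (\<lambda>i r. (if i = n then v n r else u (i + 1) r) * t i r * v i r))"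
  proof (rule SpSI_cong_arrows[OF f n act_SpRep[OF n diag_rep_SpRep[OF n] gh] diag_rep_SpRep[OF n]])
    fix i assume "1 \<le> i" "i \<le> n"
    then show "act n g h (diag_rep n \<alpha> t) i =
      diag_rep n \<alpha> (\<lambda>i r. (if i = n then v n r else u (i + 1) r) * t i r * v i r) i"
      by (cases "i = n") (auto simp: act_def diag_rep_def g_def h_def tgt_dim_def diag_rect_mult)
  qed
  finally show ?thesis ..
qed

lemma diag_monom_scale:
  "diag_monom n \<alpha> m (\<lambda>i r. t i r * (z ^ a i r * y ^ b i r)) = diag_monom n \<alpha> m t *
     (z ^ (\<Sum>i\<in>{1..n}. \<Sum>r<min_dim n \<alpha> i. a i r * m i r) * y ^ (\<Sum>i\<in>{1..n}. \<Sum>r<min_dim n \<alpha> i. b i r * m i r))"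
  by (simp add: diag_monom_def power_mult_distrib prod.distrib power_sum power_mult)

text \<open>If \<open>(i1, r1)\<close> lies outside the range of summation, both sides are 0 by
  \<open>supported\<close>; this covers the fictitious arrow 0 to the left of vertex 1.\<close>

lemma sum_single_supported:
  assumes "supported n \<alpha> m"
  shows "(\<Sum>i\<in>{1..n}. \<Sum>r<min_dim n \<alpha> i. (if i = i1 \<and> r = r1 then c else 0) * m i r) = c * m i1 r1"
proof -
  have "(\<Sum>r<min_dim n \<alpha> i. (if i = i1 \<and> r = r1 then c else 0) * m i r) =
    (\<Sum>r<min_dim n \<alpha> i. if r = r1 then (if i = i1 then c * m i1 r1 else 0) else 0)" for i
    by (intro sum.cong) auto
  then have "(\<Sum>i\<in>{1..n}. \<Sum>r<min_dim n \<alpha> i. (if i = i1 \<and> r = r1 then c else 0) * m i r) =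
    (\<Sum>i\<in>{1..n}. if i = i1 then (if r1 < min_dim n \<alpha> i1 then c * m i1 r1 else 0) else 0)"
    by (intro sum.cong) auto
  also have "\<dots> = c * m i1 r1" using assms by (auto simp: supported_def)
  finally show ?thesis .
qed

definition balanced_at :: "nat \<Rightarrow> nat \<Rightarrow> nat \<Rightarrow> (nat \<Rightarrow> nat \<Rightarrow> nat) \<Rightarrow> bool" where
  "balanced_at n i s m \<longleftrightarrow> m (i - 1) 0 + vertex_mult n i * m i s = m (i - 1) s + vertex_mult n i * m i 0"

text \<open>The one-parameter subgroup with \<open>z\<close> in row 0 and \<open>inverse z\<close>
  in row \<open>s\<close> at vertex \<open>i0\<close> scales each monomial by a power of
  \<open>z\<close>, and invariance leaves only the terms of exponent 0. The point \<open>t\<close>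
  is fixed throughout, so the coefficients of the Laurent sum are numbers.\<close>

lemma SpSI_filter_balanced_at:
  fixes f :: "(nat \<Rightarrow> 'k::field_char_0 mat) \<Rightarrow> 'k"
  assumes f: "f \<in> SpSI n \<alpha>" and n: "n \<ge> 1" and i0: "1 \<le> i0" "i0 \<le> n" and s: "0 < s" "s < \<alpha> i0"
    and xs: "\<forall>x\<in>set xs. supported n \<alpha> (snd x)" "\<And>t. f (diag_rep n \<alpha> t) = sum_monoms n \<alpha> xs t"
  shows "f (diag_rep n \<alpha> t) = sum_monoms n \<alpha> (filter (\<lambda>x. balanced_at n i0 s (snd x)) xs) t"
proof -
  define a where "a i r = (if i = i0 - 1 \<and> r = 0 then 1 else 0) + (if i = i0 \<and> r = s then vertex_mult n i0 else 0)" for i r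
  define b where "b i r = (if i = i0 - 1 \<and> r = s then 1 else 0) + (if i = i0 \<and> r = 0 then vertex_mult n i0 else 0)" for i r
  define A where "A x = (\<Sum>i\<in>{1..n}. \<Sum>r<min_dim n \<alpha> i. a i r * snd x i r)" for x :: "'k \<times> (nat \<Rightarrow> nat \<Rightarrow> nat)"
  define B where "B x = (\<Sum>i\<in>{1..n}. \<Sum>r<min_dim n \<alpha> i. b i r * snd x i r)" for x :: "'k \<times> (nat \<Rightarrow> nat \<Rightarrow> nat)"
  have AB: "(A x = B x) = balanced_at n i0 s (snd x)" if "x \<in> set xs" for x
  proof -
    have sup: "supported n \<alpha> (snd x)" using xs(1) that by blast
    have "A x = snd x (i0 - 1) 0 + vertex_mult n i0 * snd x i0 s"
      unfolding A_def a_def add_mult_distrib sum.distrib sum_single_supported[OF sup] by simp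
    moreover have "B x = snd x (i0 - 1) s + vertex_mult n i0 * snd x i0 0"
      unfolding B_def b_def add_mult_distrib sum.distrib sum_single_supported[OF sup] by simp
    ultimately show ?thesis by (simp add: balanced_at_def)
  qed
  have "(\<Sum>x\<leftarrow>xs. fst x * diag_monom n \<alpha> (snd x) t * (z ^ A x * inverse z ^ B x)) = f (diag_rep n \<alpha> t)"
    if z: "z \<noteq> 0" for z
  proof -
    define u where "u i r = (if i = i0 \<and> r = 0 then z else if i = i0 \<and> r = s then inverse z else 1)" for i r
    define v where "v i r = (if i = i0 \<and> r = 0 then inverse z else if i = i0 \<and> r = s then z else 1)" for i r
    have prod1: "(\<Prod>r<\<alpha> i. u i r) = 1" for i
    proof (cases "i = i0")
      case True
      have "(\<Prod>r<\<alpha> i. u i r) = (\<Prod>r\<in>{0, s}. u i r)"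
        by (rule prod.mono_neutral_right) (use True s in \<open>auto simp: u_def\<close>)
      then show ?thesis using True s z by (simp add: u_def)
    qed (simp add: u_def)
    have "f (diag_rep n \<alpha> t) = f (diag_rep n \<alpha> (\<lambda>i r. (if i = n then v n r else u (i + 1) r) * t i r * v i r))"
      by (rule SpSI_diag_torus[OF f n, symmetric]) (use z prod1 in \<open>auto simp: u_def v_def\<close>)
    also have "\<dots> = f (diag_rep n \<alpha> (\<lambda>i r. t i r * (z ^ a i r * inverse z ^ b i r)))"
    proof (rule SpSI_cong_arrows[OF f n diag_rep_SpRep[OF n] diag_rep_SpRep[OF n]])
      fix i assume "1 \<le> i" "i \<le> n"
      have "(if i = n then v n r else u (i + 1) r) * t i r * v i r = t i r * (z ^ a i r * inverse z ^ b i r)" for r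
      proof -
        consider "i = i0" | "i + 1 = i0" | "i \<noteq> i0" "i + 1 \<noteq> i0" by blast
        then show ?thesis
        proof cases
          case 1
          then have "i \<noteq> i0 - 1" using i0 by simp
          with 1 show ?thesis using s
            by (cases "i = n"; cases "r = 0"; cases "r = s")
              (simp_all add: u_def v_def a_def b_def vertex_mult_def power2_eq_square)
        next
          case 2
          then have "i = i0 - 1" "i \<noteq> i0" "i \<noteq> n" using i0 by auto
          with 2 show ?thesis using s
            by (cases "r = 0"; cases "r = s") (simp_all add: u_def v_def a_def b_def)
        next
          case 3
          then have "i \<noteq> i0 - 1" using i0 by auto
          with 3 show ?thesis by (cases "i = n") (simp_all add: u_def v_def a_def b_def)
        qed
      qed
      then show "diag_rep n \<alpha> (\<lambda>i r. (if i = n then v n r else u (i + 1) r) * t i r * v i r) i =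
        diag_rep n \<alpha> (\<lambda>i r. t i r * (z ^ a i r * inverse z ^ b i r)) i"
        by (simp only: diag_rep_def)
    qed
    finally show ?thesis
      unfolding xs(2) by (simp add: sum_monoms_def diag_monom_scale A_def B_def mult.assoc)
  qed
  from sum_list_laurent_const_coeff[OF this]
  have "f (diag_rep n \<alpha> t) = sum_monoms n \<alpha> (filter (\<lambda>x. A x = B x) xs) t" by (simp add: sum_monoms_def)
  also have "filter (\<lambda>x. A x = B x) xs = filter (\<lambda>x. balanced_at n i0 s (snd x)) xs"
    using AB by (rule filter_cong[OF refl])
  finally show ?thesis .
qed

text \<open>The filters for the finitely many pairs in \<open>C\<close> are applied one after
  another; each only removes terms, so earlier conditions persist. Comparison of every row with row
  0 yields all pairs of rows.\<close>

lemma SpSI_diag_rep_balanced: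
  fixes f :: "(nat \<Rightarrow> 'k::field_char_0 mat) \<Rightarrow> 'k"
  assumes f: "f \<in> SpSI n \<alpha>" and n: "n \<ge> 1"
  shows "\<exists>xs. (\<forall>x\<in>set xs. supported n \<alpha> (snd x) \<and> balanced n \<alpha> (snd x)) \<and>
    (\<forall>t. f (diag_rep n \<alpha> t) = sum_monoms n \<alpha> xs t)"
proof -
  define C where "C = Sigma {1..n} (\<lambda>i. {0<..<\<alpha> i})"
  have fin: "finite C" by (simp add: C_def)
  have filtered: "\<exists>xs. (\<forall>x\<in>set xs. supported n \<alpha> (snd x)) \<and> (\<forall>x\<in>set xs. \<forall>(i, s)\<in>D. balanced_at n i s (snd x)) \<and>
    (\<forall>t. f (diag_rep n \<alpha> t) = sum_monoms n \<alpha> xs t)" if "finite D" "D \<subseteq> C" for D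
    using that
  proof (induction D)
    case empty
    obtain q where q: "q \<in> poly_fun n \<alpha>" "\<forall>V \<in> SpRep n \<alpha>. f V = q V"
      using f unfolding SpSI_def by blast
    obtain xs where "\<forall>x\<in>set xs. supported n \<alpha> (snd x)" "\<forall>t. q (diag_rep n \<alpha> t) = sum_monoms n \<alpha> xs t"
      using poly_fun_diag_rep[OF q(1) n] by blast
    then show ?case using q(2) by (intro exI[of _ xs]) (simp add: diag_rep_SpRep[OF n])
  next
    case (insert c D)
    then obtain xs where xs: "\<forall>x\<in>set xs. supported n \<alpha> (snd x)"
      "\<forall>x\<in>set xs. \<forall>(i, s)\<in>D. balanced_at n i s (snd x)" "\<And>t. f (diag_rep n \<alpha> t) = sum_monoms n \<alpha> xs t"
      by blast
    obtain i s where c: "c = (i, s)" by fastforce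
    then have "1 \<le> i" "i \<le> n" "0 < s" "s < \<alpha> i" using insert.prems by (auto simp: C_def)
    note * = SpSI_filter_balanced_at[OF f n this xs(1,3)]
    show ?case
      by (rule exI[of _ "filter (\<lambda>x. balanced_at n i s (snd x)) xs"]) (use xs(1,2) * c in auto)
  qed
  obtain xs where xs: "\<forall>x\<in>set xs. supported n \<alpha> (snd x)"
    "\<forall>x\<in>set xs. \<forall>(i, s)\<in>C. balanced_at n i s (snd x)" "\<forall>t. f (diag_rep n \<alpha> t) = sum_monoms n \<alpha> xs t"
    using filtered[OF fin subset_refl] by blast
  have "balanced n \<alpha> (snd x)" if "x \<in> set xs" for x
    unfolding balanced_def
  proof (intro allI impI)
    fix i r s assume irs: "1 \<le> i" "i \<le> n" "r < \<alpha> i" "s < \<alpha> i"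
    have "balanced_at n i r' (snd x)" if "r' < \<alpha> i" for r'
      using xs(2) \<open>x \<in> set xs\<close> irs that by (cases "r' = 0") (auto simp: C_def balanced_at_def)
    from this[OF irs(3)] this[OF irs(4)]
    show "snd x (i - 1) r + vertex_mult n i * snd x i s = snd x (i - 1) s + vertex_mult n i * snd x i r"
      unfolding balanced_at_def by linarith
  qed
  then show ?thesis using xs by blast
qed

lemma SpSI_diag_rep_gen_alg:
  fixes f :: "(nat \<Rightarrow> 'k::field_char_0 mat) \<Rightarrow> 'k"
  assumes f: "f \<in> SpSI n \<alpha>" and n: "n \<ge> 1"
  shows "\<exists>p \<in> gen_alg (gens_i n \<alpha> \<union> gens_ii n \<alpha>). \<forall>t. f (diag_rep n \<alpha> t) = p (diag_rep n \<alpha> t)"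
proof -
  have "\<exists>p \<in> gen_alg (gens_i n \<alpha> \<union> gens_ii n \<alpha>). \<forall>t :: nat \<Rightarrow> nat \<Rightarrow> 'k. sum_monoms n \<alpha> xs t = p (diag_rep n \<alpha> t)"
    if "\<forall>x\<in>set xs. supported n \<alpha> (snd x) \<and> balanced n \<alpha> (snd x)" for xs
    using that
  proof (induction xs)
    case Nil
    show ?case by (intro bexI[OF _ ga_const[of 0]]) (simp add: sum_monoms_def)
  next
    case (Cons x xs)
    then obtain p where p: "p \<in> gen_alg (gens_i n \<alpha> \<union> gens_ii n \<alpha>)"
      "\<forall>t :: nat \<Rightarrow> nat \<Rightarrow> 'k. sum_monoms n \<alpha> xs t = p (diag_rep n \<alpha> t)" by auto
    obtain q where q: "q \<in> gen_alg (gens_i n \<alpha> \<union> gens_ii n \<alpha>)"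
      "\<forall>t :: nat \<Rightarrow> nat \<Rightarrow> 'k. diag_monom n \<alpha> (snd x) t = q (diag_rep n \<alpha> t)"
      using balanced_diag_monom_gen_alg[of n \<alpha> "snd x"] Cons.prems by auto
    have "sum_monoms n \<alpha> (x # xs) t = fst x * q (diag_rep n \<alpha> t) + p (diag_rep n \<alpha> t)" for t
      using p(2) q(2) by (simp add: sum_monoms_def)
    then show ?case
      by (intro bexI[OF _ ga_add[OF ga_mult[OF ga_const[of "fst x"] q(1)] p(1)]]) simp
  qed
  moreover obtain xs where "\<forall>x\<in>set xs. supported n \<alpha> (snd x) \<and> balanced n \<alpha> (snd x)"
    "\<forall>t. f (diag_rep n \<alpha> t) = sum_monoms n \<alpha> xs t"
    using SpSI_diag_rep_balanced[OF f n] by blast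
  ultimately show ?thesis by simp
qed

subsection \<open>Gaussian elimination\<close>

text \<open>One elimination step: on the right it adds multiples of column \<open>k\<close> to other
  columns; transposed and on the left, multiples of row \<open>k\<close> to other rows. For
  \<open>k \<ge> N\<close> it is the identity, so one index \<open>k\<close> serves vertices of all
  dimensions.\<close>

definition elim_mat :: "nat \<Rightarrow> nat \<Rightarrow> (nat \<Rightarrow> 'k::comm_ring_1) \<Rightarrow> 'k mat" where
  "elim_mat N k u = mat N N (\<lambda>(r, s). (if r = s then 1 else 0) + (if r = k then u s else 0))"

lemma elim_mat_carrier [simp]: "elim_mat N k u \<in> carrier_mat N N"
  by (simp add: elim_mat_def)

lemma dim_elim_mat [simp]: "dim_row (elim_mat N k u) = N" "dim_col (elim_mat N k u) = N"
  by (simp_all add: elim_mat_def)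

lemma index_elim_mat [simp]:
  "r < N \<Longrightarrow> s < N \<Longrightarrow> elim_mat N k u $$ (r, s) = (if r = s then 1 else 0) + (if r = k then u s else 0)"
  by (simp add: elim_mat_def)

lemma index_mult_elim_mat:
  assumes "A \<in> carrier_mat M N" "r < M" "s < N"
  shows "(A * elim_mat N k u) $$ (r, s) = A $$ (r, s) + (if k < N then A $$ (r, k) * u s else 0)"
proof -
  have "(A * elim_mat N k u) $$ (r, s) =
    (\<Sum>x\<in>{0..<N}. (if x = s then A $$ (r, s) else 0) + (if x = k then A $$ (r, k) * u s else 0))"
    using assms by (auto simp: scalar_prod_def intro!: sum.cong simp: distrib_left)
  also have "\<dots> = A $$ (r, s) + (if k < N then A $$ (r, k) * u s else 0)"
    using assms by (simp add: sum.distrib)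
  finally show ?thesis .
qed

lemma index_elim_mat_mult:
  assumes "A \<in> carrier_mat N M" "r < N" "s < M"
  shows "(elim_mat N k u * A) $$ (r, s) = A $$ (r, s) + (if r = k then (\<Sum>x<N. u x * A $$ (x, s)) else 0)"
proof -
  have "(elim_mat N k u * A) $$ (r, s) =
    (\<Sum>x\<in>{0..<N}. (if x = r then A $$ (r, s) else 0) + (if r = k then u x * A $$ (x, s) else 0))"
    using assms by (auto simp: scalar_prod_def intro!: sum.cong simp: distrib_right)
  also have "\<dots> = A $$ (r, s) + (if r = k then (\<Sum>x<N. u x * A $$ (x, s)) else 0)"
    using assms by (simp add: sum.distrib atLeast0LessThan)
  finally show ?thesis .
qed

lemma index_transpose_elim_mat_mult:
  assumes "A \<in> carrier_mat N M" "r < N" "s < M"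
  shows "(transpose_mat (elim_mat N k u) * A) $$ (r, s) = A $$ (r, s) + (if k < N then u r * A $$ (k, s) else 0)"
proof -
  have "(transpose_mat (elim_mat N k u) * A) $$ (r, s) =
    (\<Sum>x\<in>{0..<N}. (if x = r then A $$ (r, s) else 0) + (if x = k then u r * A $$ (k, s) else 0))"
    using assms by (auto simp: scalar_prod_def intro!: sum.cong simp: distrib_right)
  also have "\<dots> = A $$ (r, s) + (if k < N then u r * A $$ (k, s) else 0)"
    using assms by (simp add: sum.distrib)
  finally show ?thesis .
qed

lemma elim_mat_inverse:
  assumes "u k = 0"
  shows "elim_mat N k u * elim_mat N k (\<lambda>s. - u s) = 1\<^sub>m N" "elim_mat N k (\<lambda>s. - u s) * elim_mat N k u = 1\<^sub>m N"
proof -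
  show "elim_mat N k u * elim_mat N k (\<lambda>s. - u s) = 1\<^sub>m N"
    using assms by (intro eq_matI) (auto simp: index_mult_elim_mat[of _ N] simp del: index_mult_mat(1))
  show "elim_mat N k (\<lambda>s. - u s) * elim_mat N k u = 1\<^sub>m N"
    using assms by (intro eq_matI) (auto simp: index_mult_elim_mat[of _ N] simp del: index_mult_mat(1))
qed

lemma det_elim_mat:
  assumes "\<And>s. s \<le> k \<Longrightarrow> u s = 0"
  shows "det (elim_mat N k u) = 1"
proof -
  have "upper_triangular (elim_mat N k u)" using assms by auto
  then have "det (elim_mat N k u) = (\<Prod>r = 0..<N. elim_mat N k u $$ (r, r))"
    by (simp add: det_upper_triangular[of _ N] prod_list_diag_prod)
  also have "\<dots> = (\<Prod>r = 0..<N. 1)" by (rule prod.cong) (use assms in auto)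
  finally show ?thesis by simp
qed

text \<open>Beyond the diagonal matrix itself, both products have entries only in row
  \<open>k\<close>: \<open>u s * \<tau> s\<close> on the left, and \<open>\<tau> k\<close> times the
  new multiplier on the right. The new multipliers still vanish up to \<open>k\<close>, so the
  matrix that comes out is again unitriangular.\<close>

lemma elim_mat_diag_rect_commute:
  fixes \<tau> :: "nat \<Rightarrow> 'k::field"
  assumes u: "\<And>s. s \<le> k \<Longrightarrow> u s = 0" and \<tau>: "\<And>r. r < min a b \<Longrightarrow> \<tau> r \<noteq> 0"
  shows "elim_mat a k u * diag_rect a b \<tau> =
    diag_rect a b \<tau> * elim_mat b k (\<lambda>s. if s < min a b then u s * \<tau> s / \<tau> k else 0)"
proof (rule eq_matI)
  let ?v = "\<lambda>s. if s < min a b then u s * \<tau> s / \<tau> k else 0"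
  fix r s assume "r < dim_row (diag_rect a b \<tau> * elim_mat b k ?v)" "s < dim_col (diag_rect a b \<tau> * elim_mat b k ?v)"
  then have rs: "r < a" "s < b" by auto
  have "(\<Sum>x<a. u x * diag_rect a b \<tau> $$ (x, s)) = (\<Sum>x<a. if x = s then u s * \<tau> s else 0)"
    using rs by (intro sum.cong) auto
  then have sum: "(\<Sum>x<a. u x * diag_rect a b \<tau> $$ (x, s)) = (if s < a then u s * \<tau> s else 0)"
    by simp
  have L: "(elim_mat a k u * diag_rect a b \<tau>) $$ (r, s) =
    (if r = s then \<tau> r else 0) + (if r = k then (if s < a then u s * \<tau> s else 0) else 0)"
    unfolding index_elim_mat_mult[OF diag_rect_carrier rs] sum using rs by simp
  have R: "(diag_rect a b \<tau> * elim_mat b k ?v) $$ (r, s) =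
    (if r = s then \<tau> r else 0) + (if k < b \<and> r = k then \<tau> k * ?v s else 0)"
    using rs by (simp add: index_mult_elim_mat[OF diag_rect_carrier] del: index_mult_mat(1))
  show "(elim_mat a k u * diag_rect a b \<tau>) $$ (r, s) = (diag_rect a b \<tau> * elim_mat b k ?v) $$ (r, s)"
  proof (cases "r = k")
    case True
    show ?thesis
    proof (cases "k < b")
      case True
      then have "\<tau> k \<noteq> 0" using \<tau> rs \<open>r = k\<close> by simp
      then show ?thesis unfolding L R using rs \<open>r = k\<close> True by simp
    next
      case False
      then have "u s = 0" using u rs by simp
      then show ?thesis unfolding L R using False by simp
    qed
  next
    case False
    then show ?thesis unfolding L R by simp
  qed
qed simp_all

text \<open>Passage to the Schur complement. Row \<open>k\<close> and column \<open>k\<close> are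
  already zero at indices below \<open>k\<close>, so adding multiples of them does not disturb the
  positions cleared earlier.\<close>

lemma elim_pivot:
  fixes A :: "'k::field mat"
  assumes A: "A \<in> carrier_mat a b" and k: "k < a" "k < b" and piv: "A $$ (k, k) \<noteq> 0"
    and zero: "\<And>r s. r < a \<Longrightarrow> s < b \<Longrightarrow> r \<noteq> s \<Longrightarrow> min r s < k \<Longrightarrow> A $$ (r, s) = 0"
    and l: "\<And>r. l r = (if k < r then A $$ (r, k) / A $$ (k, k) else 0)"
    and u: "\<And>s. u s = (if k < s then A $$ (k, s) / A $$ (k, k) else 0)"
    and rs: "r < a" "s < b" "r \<noteq> s" "min r s < Suc k"
  shows "(transpose_mat (elim_mat a k (\<lambda>r. - l r)) * A * elim_mat b k (\<lambda>s. - u s)) $$ (r, s) = 0"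
proof -
  let ?X = "transpose_mat (elim_mat a k (\<lambda>r. - l r)) * A"
  have X: "?X \<in> carrier_mat a b" using A by (intro mult_carrier_mat[of _ a a]) auto
  have "?X $$ (r, s') = A $$ (r, s') - l r * A $$ (k, s')" if "s' < b" for s'
    using index_transpose_elim_mat_mult[OF A rs(1) that] k by simp
  then have eq: "(?X * elim_mat b k (\<lambda>s. - u s)) $$ (r, s) =
    A $$ (r, s) - l r * A $$ (k, s) - (A $$ (r, k) - l r * A $$ (k, k)) * u s"
    using index_mult_elim_mat[OF X rs(1,2)] k rs by simp
  consider "r = k" "k < s" | "r = k" "s < k" | "s = k" "k < r" | "s = k" "r < k" | "r < k" "s \<noteq> k" | "s < k" "r > k"
    using rs(3,4) by linarith
  then show ?thesis
  proof cases
    case 1 then show ?thesis using piv unfolding eq by (simp add: l u)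
  next
    case 2 then show ?thesis using zero[of k s] k rs unfolding eq by (simp add: l u)
  next
    case 3 then show ?thesis using piv unfolding eq by (simp add: l u)
  next
    case 4 then show ?thesis using zero[of r k] k rs unfolding eq by (simp add: l u)
  next
    case 5 then show ?thesis using zero[of r s] zero[of r k] k rs unfolding eq by (simp add: l u)
  next
    case 6 then show ?thesis using zero[of r s] zero[of k s] k rs unfolding eq by (simp add: l u)
  qed
qed

text \<open>These sets shrink from all of \<open>SpRep n \<alpha>\<close> at \<open>j = 1\<close>,
  \<open>k = 0\<close> to the representations diagonal on every arrow at \<open>j = n + 1\<close>.
  Diagonal entries are left free, so that shifting them preserves membership.\<close>

definition elim_set :: "nat \<Rightarrow> (nat \<Rightarrow> nat) \<Rightarrow> nat \<Rightarrow> nat \<Rightarrow> (nat \<Rightarrow> 'k::field mat) set" where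
  "elim_set n \<alpha> j k = {V \<in> SpRep n \<alpha>. \<forall>i r s. 1 \<le> i \<longrightarrow> i \<le> n \<longrightarrow> r < tgt_dim n \<alpha> i \<longrightarrow> s < \<alpha> i \<longrightarrow> r \<noteq> s \<longrightarrow>
     i < j \<or> i = j \<and> min r s < k \<longrightarrow> V i $$ (r, s) = 0}"

text \<open>The recursion descends from the prescribed value at \<open>j\<close>; generalising over
  the end value lets the induction on \<open>j\<close> insert \<open>F j u0\<close> as the next
  one.\<close>

lemma ex_backward_rec: "\<exists>u. u j = u0 \<and> (\<forall>i<j. u i = F i (u (Suc i)))"
proof (induction j arbitrary: u0)
  case (Suc j)
  then obtain u where u: "u j = F j u0" "\<forall>i<j. u i = F i (u (Suc i))" by blast
  show ?case by (rule exI[of _ "u(Suc j := u0)"]) (use u in \<open>auto simp: less_Suc_eq\<close>)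
qed auto

text \<open>The row operation at vertex \<open>j\<close> is propagated to the vertices \<open>i < j\<close> so that it commutes with the
  diagonal matrices already obtained there.\<close>
lemma elim_step:
  fixes V :: "nat \<Rightarrow> 'k::field mat"
  assumes n: "n \<ge> 1" and j: "1 \<le> j" "j \<le> n" and k: "k < min_dim n \<alpha> j" and V: "V \<in> elim_set n \<alpha> j k"
    and nz: "\<And>i r. 1 \<le> i \<Longrightarrow> i \<le> n \<Longrightarrow> r < min_dim n \<alpha> i \<Longrightarrow> V i $$ (r, r) \<noteq> 0"
  shows "\<exists>g h. (g, h) \<in> SSp n \<alpha> \<and> act n g h V \<in> elim_set n \<alpha> j (Suc k)"
proof -
  have VR: "V \<in> SpRep n \<alpha>" using V by (simp add: elim_set_def)
  have zero: "V i $$ (r, s) = 0" if "1 \<le> i" "i \<le> n" "r < tgt_dim n \<alpha> i" "s < \<alpha> i" "r \<noteq> s"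
    "i < j \<or> i = j \<and> min r s < k" for i r s
    using V that unfolding elim_set_def by blast
  define l where "l r = (if k < r then V j $$ (r, k) / V j $$ (k, k) else 0)" for r
  define uj where "uj s = (if k < s then V j $$ (k, s) / V j $$ (k, k) else 0)" for s
  obtain u where u: "u j = uj" "\<And>i. i < j \<Longrightarrow>
      u i = (\<lambda>s. if s < min_dim n \<alpha> i then u (Suc i) s * V i $$ (s, s) / V i $$ (k, k) else 0)"
    using ex_backward_rec[of j uj
      "\<lambda>i w s. if s < min_dim n \<alpha> i then w s * V i $$ (s, s) / V i $$ (k, k) else 0"] by blast
  have u0: "u i s = 0" if "i \<le> j" "s \<le> k" for i s
    using that(1)
  proof (induction rule: inc_induct)
    case base
    then show ?case using that(2) u(1) by (simp add: uj_def)
  next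
    case (step i)
    then show ?case using u(2)[of i] by simp
  qed
  \<comment> \<open>The transposed matrix at \<open>Suc j\<close> performs the row operation on
    arrow \<open>j\<close>. It may also change arrow \<open>Suc j\<close>, on which
    \<open>elim_set n \<alpha> j (Suc k)\<close> imposes nothing yet.\<close>
  define g where "g i = (if i \<le> j then elim_mat (\<alpha> i) k (u i)
    else if i = Suc j then transpose_mat (elim_mat (\<alpha> i) k (\<lambda>r. - l r)) else 1\<^sub>m (\<alpha> i))" for i
  define h where "h i = (if i \<le> j then elim_mat (\<alpha> i) k (\<lambda>s. - u i s)
    else if i = Suc j then transpose_mat (elim_mat (\<alpha> i) k l) else 1\<^sub>m (\<alpha> i))" for i
  have gh: "(g, h) \<in> SSp n \<alpha>"
  proof -
    have "g i \<in> carrier_mat (\<alpha> i) (\<alpha> i) \<and> h i \<in> carrier_mat (\<alpha> i) (\<alpha> i) \<and>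
      g i * h i = 1\<^sub>m (\<alpha> i) \<and> h i * g i = 1\<^sub>m (\<alpha> i) \<and> det (g i) = 1" for i
    proof -
      consider "i \<le> j" | "i = Suc j" | "i > Suc j" by linarith
      then show ?thesis
      proof cases
        case 1
        then show ?thesis using u0[OF 1] by (simp add: g_def h_def elim_mat_inverse det_elim_mat)
      next
        case 2
        let ?E = "elim_mat (\<alpha> i) k"
        have "l k = 0" by (simp add: l_def)
        note inv = elim_mat_inverse[of l k "\<alpha> i", OF this]
        have "transpose_mat (?E (\<lambda>r. - l r)) * transpose_mat (?E l) = 1\<^sub>m (\<alpha> i)"
          "transpose_mat (?E l) * transpose_mat (?E (\<lambda>r. - l r)) = 1\<^sub>m (\<alpha> i)"
          using inv by (simp_all flip: transpose_mult[of _ "\<alpha> i" "\<alpha> i" _ "\<alpha> i"])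
        moreover have "det (transpose_mat (?E (\<lambda>r. - l r))) = 1"
          by (subst det_transpose[of _ "\<alpha> i"]) (auto simp: l_def intro!: det_elim_mat)
        ultimately show ?thesis using 2 by (simp add: g_def h_def)
      next
        case 3
        then show ?thesis by (simp add: g_def h_def)
      qed
    qed
    then show ?thesis unfolding SSp_def by auto
  qed
  have below: "act n g h V i = V i" if i: "1 \<le> i" "i < j" for i
  proof -
    let ?a = "\<alpha> (i + 1)" and ?b = "\<alpha> i"
    have Vi: "V i \<in> carrier_mat ?a ?b" and md: "min_dim n \<alpha> i = min ?a ?b"
      using SpRep_carrier[OF VR, of i] i j by (auto simp: tgt_dim_def min_dim_def)
    define \<tau> where "\<tau> r = V i $$ (r, r)" for r
    have D: "V i = diag_rect ?a ?b \<tau>"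
      using Vi zero[of i] i j by (intro eq_matI) (auto simp: tgt_dim_def \<tau>_def)
    have ui: "u i = (\<lambda>s. if s < min ?a ?b then u (i + 1) s * \<tau> s / \<tau> k else 0)"
      unfolding u(2)[OF i(2)] md \<tau>_def by (simp only: Suc_eq_plus1)
    have gi: "g (i + 1) = elim_mat ?a k (u (i + 1))" "g i = elim_mat ?b k (u i)" using i by (auto simp: g_def)
    have "\<tau> r \<noteq> 0" if "r < min ?a ?b" for r using nz[of i r] that md i j by (simp add: \<tau>_def)
    then have "g (i + 1) * V i = V i * g i"
      unfolding gi ui D using u0[of "i + 1"] i by (intro elim_mat_diag_rect_commute) auto
    then have "g (i + 1) * V i * h i = V i * (g i * h i)"
      using Vi SSp_D[OF gh, of i] i j by (simp add: assoc_mult_mat[of _ ?a ?b _ ?b _ ?b])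
    then show ?thesis using Vi SSp_D[OF gh, of i] i j by (simp add: act_def)
  qed
  have Vj: "V j \<in> carrier_mat (tgt_dim n \<alpha> j) (\<alpha> j)" using SpRep_carrier[OF VR] j by simp
  have at_j: "act n g h V j = transpose_mat (elim_mat (tgt_dim n \<alpha> j) k (\<lambda>r. - l r)) * V j * elim_mat (\<alpha> j) k (\<lambda>s. - uj s)"
  proof (cases "j = n")
    case True
    \<comment> \<open>The form is multiplied by \<open>h n\<close> on the right and by its transpose
      on the left, so the row and column multipliers have to coincide; symmetry of the form provides
      this.\<close>
    have "k < \<alpha> n" using k True by (simp add: min_dim_def)
    then have "uj s = l s" if "s < \<alpha> n" for s
      using SpRep_sym[OF VR _ that, of k] True by (simp add: uj_def l_def)
    then have "elim_mat (\<alpha> n) k (\<lambda>s. - uj s) = elim_mat (\<alpha> n) k (\<lambda>r. - l r)"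
      by (intro eq_matI) auto
    then show ?thesis using True u(1) by (simp add: act_def h_def tgt_dim_def)
  next
    case False
    then show ?thesis using j u(1) by (simp add: act_def g_def h_def tgt_dim_def)
  qed
  have "act n g h V i $$ (r, s) = 0" if "1 \<le> i" "i \<le> n" "r < tgt_dim n \<alpha> i" "s < \<alpha> i" "r \<noteq> s"
    "i < j \<or> i = j \<and> min r s < Suc k" for i r s
  proof (cases "i < j")
    case True
    then show ?thesis using below[of i] zero[of i r s] that by simp
  next
    case False
    then have i: "i = j" "min r s < Suc k" using that by auto
    have kk: "k < tgt_dim n \<alpha> j" "k < \<alpha> j" using k by (auto simp: min_dim_def)
    have z: "V j $$ (r', s') = 0" if "r' < tgt_dim n \<alpha> j" "s' < \<alpha> j" "r' \<noteq> s'" "min r' s' < k" for r' s'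
      using zero[OF j that(1-3)] that(4) by simp
    show ?thesis
      unfolding i(1) at_j
      by (rule elim_pivot[OF Vj kk nz[OF j k] z l_def uj_def]) (use that i in simp_all)
  qed
  then have "act n g h V \<in> elim_set n \<alpha> j (Suc k)"
    using act_SpRep[OF n VR gh] unfolding elim_set_def by blast
  then show ?thesis using gh by blast
qed

section \<open>Perturbation of the pivots\<close>

definition shift_rep :: "nat \<Rightarrow> (nat \<Rightarrow> nat) \<Rightarrow> (nat \<Rightarrow> 'k::field mat) \<Rightarrow> 'k \<Rightarrow> nat \<Rightarrow> 'k mat" where
  "shift_rep n \<alpha> V c i = mat (tgt_dim n \<alpha> i) (\<alpha> i) (\<lambda>(r, s). V i $$ (r, s) + (if r = s then c else 0))"

lemma index_shift_rep [simp]: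
  "r < tgt_dim n \<alpha> i \<Longrightarrow> s < \<alpha> i \<Longrightarrow>
    shift_rep n \<alpha> V c i $$ (r, s) = V i $$ (r, s) + (if r = s then c else 0)"
  by (simp add: shift_rep_def)

lemma shift_rep_SpRep:
  assumes "n \<ge> 1" "V \<in> SpRep n \<alpha>"
  shows "shift_rep n \<alpha> V c \<in> SpRep n \<alpha>"
proof -
  have "transpose_mat (shift_rep n \<alpha> V c n) = shift_rep n \<alpha> V c n"
    using SpRep_sym[OF assms(2)] by (intro eq_matI) (auto simp: shift_rep_def tgt_dim_def)
  then show ?thesis using assms by (auto simp: SpRep_iff shift_rep_def)
qed

lemma shift_rep_elim_set:
  assumes "n \<ge> 1" "V \<in> elim_set n \<alpha> j k"
  shows "shift_rep n \<alpha> V c \<in> elim_set n \<alpha> j k"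
proof -
  have V: "V \<in> SpRep n \<alpha>" using assms by (simp add: elim_set_def)
  have "shift_rep n \<alpha> V c i $$ (r, s) = 0" if "1 \<le> i" "i \<le> n" "r < tgt_dim n \<alpha> i" "s < \<alpha> i" "r \<noteq> s"
    "i < j \<or> i = j \<and> min r s < k" for i r s
  proof -
    have "V i $$ (r, s) = 0" using assms(2) that unfolding elim_set_def by blast
    then show ?thesis using that by simp
  qed
  then show ?thesis using shift_rep_SpRep[OF assms(1) V] unfolding elim_set_def by blast
qed

lemma poly_fun_shift_rep:
  assumes "q \<in> poly_fun n \<alpha>" "n \<ge> 1"
  shows "\<exists>p. \<forall>c. q (shift_rep n \<alpha> V c) = poly p c"
  using assms
proof (induction rule: poly_fun_induct')
  case (const c)
  show ?case by (rule exI[of _ "[:c:]"]) simp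
next
  case (coord i r s)
  show ?case by (rule exI[of _ "[:V i $$ (r, s), if r = s then 1 else 0:]"]) (use coord in simp)
next
  case (add f g)
  then obtain p p' where "\<forall>c. f (shift_rep n \<alpha> V c) = poly p c" "\<forall>c. g (shift_rep n \<alpha> V c) = poly p' c" by blast
  then show ?case by (intro exI[of _ "p + p'"]) simp
next
  case (mult f g)
  then obtain p p' where "\<forall>c. f (shift_rep n \<alpha> V c) = poly p c" "\<forall>c. g (shift_rep n \<alpha> V c) = poly p' c" by blast
  then show ?case by (intro exI[of _ "p * p'"]) simp
qed

text \<open>Adding \<open>c\<close> to all diagonal entries makes the pivots nonzero for all but finitely many \<open>c\<close>, so a
  polynomial that vanishes at all such shifts vanishes at \<open>c = 0\<close>.\<close>
lemma SpSI_vanish_step: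
  fixes f :: "(nat \<Rightarrow> 'k::field_char_0 mat) \<Rightarrow> 'k"
  assumes f: "f \<in> SpSI n \<alpha>" and n: "n \<ge> 1" and j: "1 \<le> j" "j \<le> n" and k: "k < min_dim n \<alpha> j"
    and vanish: "\<And>V. V \<in> elim_set n \<alpha> j (Suc k) \<Longrightarrow> f V = 0" and V: "V \<in> elim_set n \<alpha> j k"
  shows "f V = 0"
proof -
  have VR: "V \<in> SpRep n \<alpha>" using V by (simp add: elim_set_def)
  obtain q where q: "q \<in> poly_fun n \<alpha>" "\<forall>V \<in> SpRep n \<alpha>. f V = q V"
    using f unfolding SpSI_def by blast
  obtain p where "\<forall>c. q (shift_rep n \<alpha> V c) = poly p c"
    using poly_fun_shift_rep[OF q(1) n] by blast
  then have p: "f (shift_rep n \<alpha> V c) = poly p c" for c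
    using q(2) shift_rep_SpRep[OF n VR] by simp
  define bad where "bad = (\<lambda>(i, r). - V i $$ (r, r)) ` Sigma {1..n} (\<lambda>i. {..<min_dim n \<alpha> i})"
  have "finite bad" by (simp add: bad_def)
  have "poly p c = 0" if c: "c \<notin> bad" for c
  proof -
    have "shift_rep n \<alpha> V c i $$ (r, r) \<noteq> 0" if ir: "1 \<le> i" "i \<le> n" "r < min_dim n \<alpha> i" for i r
    proof
      assume "shift_rep n \<alpha> V c i $$ (r, r) = 0"
      then have "V i $$ (r, r) + c = 0" using ir by (simp add: min_dim_def)
      then have "c = (\<lambda>(i, r). - V i $$ (r, r)) (i, r)" by (simp add: eq_neg_iff_add_eq_0 add.commute)
      then have "c \<in> bad" unfolding bad_def by (rule image_eqI) (use ir in auto)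
      then show False using c by simp
    qed
    from elim_step[OF n j k shift_rep_elim_set[OF n V] this]
    obtain g h where "(g, h) \<in> SSp n \<alpha>" "act n g h (shift_rep n \<alpha> V c) \<in> elim_set n \<alpha> j (Suc k)" by blast
    moreover from this(1) have "f (act n g h (shift_rep n \<alpha> V c)) = f (shift_rep n \<alpha> V c)"
      using f shift_rep_SpRep[OF n VR] unfolding SpSI_iff by blast
    ultimately have "f (shift_rep n \<alpha> V c) = 0" using vanish by simp
    then show ?thesis by (simp add: p)
  qed
  then have "- bad \<subseteq> {c. poly p c = 0}" by auto
  moreover have "infinite (- bad)" using \<open>finite bad\<close> by (simp add: infinite_UNIV_char_0 Compl_eq_Diff_UNIV)
  ultimately have "p = 0" using poly_roots_finite[of p] finite_subset by blast
  \<comment> \<open>The value \<open>c = 0\<close> may itself lie in \<open>bad\<close>; it is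
    reached because \<open>p\<close> is the zero polynomial.\<close>
  then have "f (shift_rep n \<alpha> V 0) = 0" by (simp add: p)
  moreover have "shift_rep n \<alpha> V 0 i = V i" if "1 \<le> i" "i \<le> n" for i
    using SpRep_carrier[OF VR that] by (intro eq_matI) (auto simp: shift_rep_def)
  then have "f (shift_rep n \<alpha> V 0) = f V"
    using SpSI_cong_arrows[OF f n shift_rep_SpRep[OF n VR] VR] by blast
  ultimately show ?thesis by simp
qed

text \<open>Vanishing spreads from the smallest \<open>elim_set\<close> to the largest, so both
  inductions descend: over the arrows, and within an arrow over its pivots.\<close>

lemma SpSI_zero_if_zero_on_diag_rep:
  fixes f :: "(nat \<Rightarrow> 'k::field_char_0 mat) \<Rightarrow> 'k"
  assumes f: "f \<in> SpSI n \<alpha>" and n: "n \<ge> 1" and diag: "\<And>t. f (diag_rep n \<alpha> t) = 0"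
    and V: "V \<in> SpRep n \<alpha>"
  shows "f V = 0"
proof -
  have vanish: "\<forall>V \<in> elim_set n \<alpha> j 0. f V = 0" if "j \<le> n + 1" "1 \<le> j" for j
    using that(1)
  proof (induction rule: inc_induct)
    case base
    show ?case
    proof
      fix V :: "nat \<Rightarrow> 'k mat" assume V: "V \<in> elim_set n \<alpha> (n + 1) 0"
      then have VR: "V \<in> SpRep n \<alpha>" by (simp add: elim_set_def)
      have "V i = diag_rep n \<alpha> (\<lambda>i r. V i $$ (r, r)) i" if "1 \<le> i" "i \<le> n" for i
        using SpRep_carrier[OF VR that] V that unfolding elim_set_def diag_rep_def
        by (intro eq_matI) auto
      then have "f V = f (diag_rep n \<alpha> (\<lambda>i r. V i $$ (r, r)))"
        by (rule SpSI_cong_arrows[OF f n VR diag_rep_SpRep[OF n]])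
      then show "f V = 0" using diag by simp
    qed
  next
    case (step j')
    have j': "1 \<le> j'" "j' \<le> n" using step that by auto
    have "\<forall>V \<in> elim_set n \<alpha> j' k. f V = 0" if "k \<le> min_dim n \<alpha> j'" for k
      using that
    proof (induction rule: inc_induct)
      case base
      \<comment> \<open>The smaller index of any position in arrow \<open>j'\<close> is below
        \<open>min_dim n \<alpha> j'\<close>, so clearing that many pivots makes the whole arrow
        diagonal, also when it is rectangular.\<close>
      have "elim_set n \<alpha> j' (min_dim n \<alpha> j') \<subseteq> (elim_set n \<alpha> (Suc j') 0 :: (nat \<Rightarrow> 'k mat) set)"
      proof
        fix V :: "nat \<Rightarrow> 'k mat" assume V: "V \<in> elim_set n \<alpha> j' (min_dim n \<alpha> j')"
        have "V i $$ (r, s) = 0" if irs: "1 \<le> i" "i \<le> n" "r < tgt_dim n \<alpha> i" "s < \<alpha> i" "r \<noteq> s"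
          "i < Suc j'" for i r s
        proof -
          have "i < j' \<or> i = j' \<and> min r s < min_dim n \<alpha> j'"
            using irs by (auto simp: min_dim_def less_Suc_eq min_less_iff_disj)
          then show ?thesis using V irs unfolding elim_set_def by blast
        qed
        then show "V \<in> elim_set n \<alpha> (Suc j') 0" using V unfolding elim_set_def by simp
      qed
      then show ?case using step.IH by blast
    next
      case (step k)
      then show ?case using SpSI_vanish_step[OF f n j', of k] by blast
    qed
    then show ?case by blast
  qed
  have "V \<in> elim_set n \<alpha> 1 0" using V by (simp add: elim_set_def)
  then show ?thesis using vanish[of 1] by simp
qed

theorem theorem2p3:
  fixes n :: nat and \<alpha> :: "nat \<Rightarrow> nat"
  assumes "alg_closed_field TYPE('k::field_char_0)"
    and "n \<ge> 1"
  shows "gens_i n \<alpha> \<union> gens_ii n \<alpha> \<subseteq> (SpSI n \<alpha> :: ((nat \<Rightarrow> 'k mat) \<Rightarrow> 'k) set)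
    \<and> (\<forall>f \<in> (SpSI n \<alpha> :: ((nat \<Rightarrow> 'k mat) \<Rightarrow> 'k) set).
         \<exists>p \<in> gen_alg (gens_i n \<alpha> \<union> gens_ii n \<alpha>). \<forall>V \<in> SpRep n \<alpha>. f V = p V)"
proof (intro conjI ballI)
  show gens: "gens_i n \<alpha> \<union> gens_ii n \<alpha> \<subseteq> (SpSI n \<alpha> :: ((nat \<Rightarrow> 'k mat) \<Rightarrow> 'k) set)"
    using gens_i_SpSI gens_ii_SpSI by blast
  fix f :: "(nat \<Rightarrow> 'k mat) \<Rightarrow> 'k" assume f: "f \<in> SpSI n \<alpha>"
  obtain p :: "(nat \<Rightarrow> 'k mat) \<Rightarrow> 'k" where p: "p \<in> gen_alg (gens_i n \<alpha> \<union> gens_ii n \<alpha>)"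
    "\<forall>t. f (diag_rep n \<alpha> t) = p (diag_rep n \<alpha> t)"
    using SpSI_diag_rep_gen_alg[OF f assms(2)] by blast
  \<comment> \<open>Two semi-invariants with the same restriction to the slice agree on
    \<open>SpRep n \<alpha>\<close>: their difference is a semi-invariant that vanishes on the
    slice.\<close>
  have diff: "(\<lambda>V. f V + - 1 * p V) \<in> SpSI n \<alpha>"
    using f gen_alg_SpSI[OF gens p(1)] by (intro SpSI_add SpSI_mult SpSI_const)
  have "f V = p V" if "V \<in> SpRep n \<alpha>" for V
    using SpSI_zero_if_zero_on_diag_rep[OF diff assms(2) _ that] p(2) by simp
  then show "\<exists>p \<in> gen_alg (gens_i n \<alpha> \<union> gens_ii n \<alpha>). \<forall>V \<in> SpRep n \<alpha>. f V = p V"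
    using p(1) by blast
qed

end
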